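(* Let $p$ be an odd prime, $n$ a positive integer, $q=p^n$, and for $c\in\mathbb{F}_q$ let $\psi_c(x)=\exp\!\big(2\pi i\operatorname{tr}_{q,p}(cx)/p\big)$. Let $a_1,\dots,a_s,b\in\mathbb{F}_q$ and let $t_1,\dots,t_s$ be positive integers dividing $n$. Let $\chi^{(j)}$ denote the quadratic character of $\mathbb{F}_{p^{t_j}}$ and $i$ the imaginary unit. Then the number of tuples $(x_1,\dots,x_s)$ with $x_j\in\mathbb{F}_{p^{t_j}}$ satisfying $a_1x_1^2+\cdots+a_sx_s^2=b$ equals $$p^{\frac{t_1+\cdots+t_s}{2}-n}\sum_{c\in\mathbb{F}_q}\psi_c(-b)\prod_{j=1}^s\Gamma_j(c),$$ where $$\Gamma_j(c)=\begin{cases}p^{t_j/2},&\text{if }\operatorname{tr}_{q,p^{t_j}}(ca_j)=0;\\ -(-1)^{t_j}\chi^{(j)}\big(\operatorname{tr}_{q,p^{t_j}}(ca_j)\big),&\text{if }\operatorname{tr}_{q,p^{t_j}}(ca_j)\ne0\text{ and }p\equiv1\pmod4;\\ -(-1)^{t_j}i^{t_j}\chi^{(j)}\big(\operatorname{tr}_{q,p^{t_j}}(ca_j)\big),&\text{if }\operatorname{tr}_{q,p^{t_j}}(ca_j)\ne0\text{ and }p\equiv3\pmod4.\end{cases}$$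
   Context: For $k\mid n$, $\operatorname{tr}_{q,p^{k}}$ denotes the trace map from $\mathbb{F}_q$ to $\mathbb{F}_{p^{k}}$. *)

theory Defs
  imports Complex_Main "HOL-Library.FuncSet" "HOL-Library.Cardinality" "HOL-Computational_Algebra.Primes"
begin

text \<open>Ambient field: a finite field of type 'a with CARD('a) = p^n.
  The subfield F_{p^t} (t dvd n) is the set of roots of x^(p^t) = x.\<close>

definition subfield_of_order :: "nat \<Rightarrow> 'a::field set" where
  "subfield_of_order m = {x. x ^ m = x}"

definition ff_trace :: "nat \<Rightarrow> nat \<Rightarrow> nat \<Rightarrow> 'a::field \<Rightarrow> 'a" where
  "ff_trace p n k x = (\<Sum>i < n div k. x ^ (p ^ (k * i)))"

definition prime_field_val :: "nat \<Rightarrow> 'a::field \<Rightarrow> nat" where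
  "prime_field_val p y = (THE m. m < p \<and> of_nat m = y)"

definition add_char :: "nat \<Rightarrow> nat \<Rightarrow> 'a::field \<Rightarrow> 'a \<Rightarrow> complex" where
  "add_char p n c x =
     exp (2 * of_real pi * \<i> * of_nat (prime_field_val p (ff_trace p n 1 (c * x))) / of_nat p)"

definition quad_char :: "nat \<Rightarrow> 'a::field \<Rightarrow> int" where
  "quad_char m y =
     (if y = 0 then 0
      else if (\<exists>z \<in> subfield_of_order m. z ^ 2 = y) then 1 else -1)"

definition Gamma_fun :: "nat \<Rightarrow> nat \<Rightarrow> nat \<Rightarrow> 'a::field \<Rightarrow> 'a \<Rightarrow> complex" where
  "Gamma_fun p n t a c =
     (let u = ff_trace p n t (c * a) in
      if u = 0 then of_real (real p powr (real t / 2))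
      else if p mod 4 = 1 then - ((-1) ^ t) * of_int (quad_char (p ^ t) u)
      else - ((-1) ^ t) * \<i> ^ t * of_int (quad_char (p ^ t) u))"

end

theory Submission
  imports Defs "HOL-Computational_Algebra.Polynomial"
begin

text \<open>
  Orthogonality of the additive characters turns the number of solutions into a sum over \<open>c\<close> of
  products of quadratic sums over the fields \<open>F t\<close>, and transitivity of the trace reduces each of
  these to \<open>S u = (\<Sum>x\<in>F t. psi t (u * x\<^sup>2))\<close>. For \<open>u \<noteq> 0\<close> one has \<open>S u = chi u * S 1\<close>, so it remains to evaluate \<open>S u\<close>
  for a single convenient \<open>u\<close>.

  Choose \<open>\<theta>\<close> in \<open>F t\<close> with \<open>t\<close> distinct conjugates, let \<open>D\<close> be the derivative of its minimal
  polynomial at \<open>\<theta>\<close>, and take \<open>u = 1 / D\<close>. By Euler's formula the trace of \<open>\<theta>^k / D\<close> vanishes for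
  \<open>k < t - 1\<close> and is \<open>1\<close> for \<open>k = t - 1\<close>. Hence the span \<open>W r\<close> of \<open>1, \<theta>, ..., \<theta>^(r-1)\<close> with \<open>r = t div 2\<close> is
  totally isotropic for the form \<open>Tr (x\<^sup>2 / D)\<close>, with orthogonal complement \<open>W (t - r)\<close>, so \<open>S u\<close> is \<open>p^r\<close> if \<open>t\<close> is
  even and \<open>p^r\<close> times the Gauss sum over the prime field if \<open>t\<close> is odd. The value of \<open>chi D\<close> is
  obtained by pairing the factors \<open>\<theta> - \<theta>^(p^i)\<close> and \<open>\<theta> - \<theta>^(p^(t-i))\<close> of \<open>D\<close>, which are conjugate up to sign.

  The sign of the Gauss sum over the prime field follows Gauss: his alternating sum of
  \<open>q\<close>-binomial coefficients at a root of unity writes the sum as a product of sines.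
\<close>

subsection \<open>The sign of the quadratic Gauss sum modulo an odd number\<close>

text \<open>The Gaussian binomial coefficient, as a product of quotients. A factor with
  \<open>q ^ Suc i = 1\<close> would be a division by zero, hence the root-of-unity hypotheses
  below. For \<open>j = m + 1\<close> the last numerator is \<open>1 - q ^ 0\<close>, so the
  coefficient vanishes just beyond its range.\<close>

definition qbin :: "'a::field \<Rightarrow> nat \<Rightarrow> nat \<Rightarrow> 'a" where
  "qbin q m j = (\<Prod>i<j. (1 - q ^ (m - i)) / (1 - q ^ Suc i))"

lemma qbin_0 [simp]: "qbin q m 0 = 1"
  by (simp add: qbin_def)

lemma qbin_Suc: "qbin q m (Suc j) = qbin q m j * ((1 - q ^ (m - j)) / (1 - q ^ Suc j))"
  by (simp add: qbin_def)

lemma qbin_eq_0: "qbin q m (Suc m) = 0"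
  by (simp add: qbin_Suc)

lemma qbin_absorb:
  assumes "q ^ Suc j \<noteq> 1"
  shows "(1 - q ^ Suc j) * qbin q (Suc m) (Suc j) = (1 - q ^ Suc m) * qbin q m j"
proof -
  have "(\<Prod>i<Suc j. 1 - q ^ (Suc m - i)) = (1 - q ^ Suc m) * (\<Prod>i<j. 1 - q ^ (m - i))"
    by (subst prod.lessThan_Suc_shift) simp
  moreover have "(\<Prod>i<Suc j. 1 - q ^ Suc i) = (\<Prod>i<j. 1 - q ^ Suc i) * (1 - q ^ Suc j)"
    by simp
  ultimately have "qbin q (Suc m) (Suc j)
      = ((1 - q ^ Suc m) * (\<Prod>i<j. 1 - q ^ (m - i))) / ((\<Prod>i<j. 1 - q ^ Suc i) * (1 - q ^ Suc j))"
    by (simp only: qbin_def prod_dividef)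
  thus ?thesis
    using assms by (simp add: qbin_def prod_dividef del: power_Suc)
qed

lemma qbin_pascal:
  assumes "q ^ Suc j \<noteq> 1" "j \<le> m"
  shows "qbin q (Suc m) (Suc j) = qbin q m j + q ^ Suc j * qbin q m (Suc j)"
proof -
  have pw: "q ^ Suc j * q ^ (m - j) = q ^ Suc m"
    using assms(2) by (simp flip: power_add)
  have "(1 - q ^ Suc j) * (qbin q m j + q ^ Suc j * qbin q m (Suc j))
      = (1 - q ^ Suc j) * qbin q m j
        + q ^ Suc j * (1 - q ^ (m - j)) * qbin q m j * ((1 - q ^ Suc j) / (1 - q ^ Suc j))"
    unfolding qbin_Suc by (simp add: distrib_left mult_ac del: power_Suc)
  also have "\<dots> = (1 - q ^ Suc j + (q ^ Suc j - q ^ Suc j * q ^ (m - j))) * qbin q m j"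
    using assms(1) by (simp add: algebra_simps del: power_Suc)
  also have "\<dots> = (1 - q ^ Suc m) * qbin q m j"
    unfolding pw by (simp add: algebra_simps)
  also have "\<dots> = (1 - q ^ Suc j) * qbin q (Suc m) (Suc j)"
    using qbin_absorb[OF assms(1)] by simp
  finally show ?thesis
    using assms(1) by simp
qed

text \<open>Gauss's recursion in steps of two. The Pascal rule lowers the upper index once and
  leaves the weights \<open>q ^ j - 1\<close>; these kill the term \<open>j = 0\<close>, and
  absorption lowers the index again, extracting the constant factor
  \<open>1 - q ^ Suc m\<close>.\<close>

lemma alternating_qbin_step:
  assumes nz: "\<And>i. i \<in> {1..Suc (Suc m)} \<Longrightarrow> q ^ i \<noteq> 1"
  shows "(\<Sum>j\<le>Suc (Suc m). (-1) ^ j * qbin q (Suc (Suc m)) j)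
       = (1 - q ^ Suc m) * (\<Sum>j\<le>m. (-1) ^ j * qbin q m j)"
proof -
  define M where "M = Suc m"
  define g where "g i = (-1) ^ i * q ^ i * qbin q M i" for i
  have "(\<Sum>j\<le>Suc M. (-1) ^ j * qbin q (Suc M) j)
      = 1 + (\<Sum>j\<le>M. (-1) ^ Suc j * qbin q (Suc M) (Suc j))"
    by (subst sum.atMost_Suc_shift) simp
  also have "(\<Sum>j\<le>M. (-1) ^ Suc j * qbin q (Suc M) (Suc j))
      = (\<Sum>j\<le>M. g (Suc j) - (-1) ^ j * qbin q M j)"
  proof (intro sum.cong refl)
    fix j assume "j \<in> {..M}"
    hence *: "qbin q (Suc M) (Suc j) = qbin q M j + q ^ Suc j * qbin q M (Suc j)"
      by (intro qbin_pascal nz) (auto simp: M_def)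
    show "(-1) ^ Suc j * qbin q (Suc M) (Suc j) = g (Suc j) - (-1) ^ j * qbin q M j"
      unfolding * g_def by (simp add: algebra_simps)
  qed
  also have "1 + \<dots> = (1 + (\<Sum>j\<le>M. g (Suc j))) - (\<Sum>j\<le>M. (-1) ^ j * qbin q M j)"
    by (simp add: sum_subtractf)
  also have "1 + (\<Sum>j\<le>M. g (Suc j)) = (\<Sum>j\<le>Suc M. g j)"
    by (subst sum.atMost_Suc_shift) (simp add: g_def)
  also have "\<dots> = (\<Sum>j\<le>M. g j)"
    by (simp add: g_def qbin_eq_0)
  also have "\<dots> - (\<Sum>j\<le>M. (-1) ^ j * qbin q M j)
      = (\<Sum>j\<le>Suc m. (-1) ^ j * ((q ^ j - 1) * qbin q (Suc m) j))"
    unfolding g_def M_def sum_subtractf[symmetric] by (intro sum.cong refl) (simp add: algebra_simps)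
  also have "\<dots> = (\<Sum>j\<le>m. (-1) ^ j * ((1 - q ^ Suc j) * qbin q (Suc m) (Suc j)))"
    by (subst sum.atMost_Suc_shift) (simp add: algebra_simps)
  also have "\<dots> = (\<Sum>j\<le>m. (-1) ^ j * ((1 - q ^ Suc m) * qbin q m j))"
  proof (intro sum.cong refl)
    fix j assume "j \<in> {..m}"
    hence "(1 - q ^ Suc j) * qbin q (Suc m) (Suc j) = (1 - q ^ Suc m) * qbin q m j"
      by (intro qbin_absorb nz) auto
    thus "(-1) ^ j * ((1 - q ^ Suc j) * qbin q (Suc m) (Suc j))
        = (-1) ^ j * ((1 - q ^ Suc m) * qbin q m j)"
      by simp
  qed
  also have "\<dots> = (1 - q ^ Suc m) * (\<Sum>j\<le>m. (-1) ^ j * qbin q m j)"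
    unfolding sum_distrib_left by (intro sum.cong refl) (simp add: algebra_simps)
  finally show ?thesis
    by (simp only: M_def)
qed

lemma alternating_qbin_sum:
  assumes "\<And>i. i \<in> {1..2*k} \<Longrightarrow> q ^ i \<noteq> 1"
  shows "(\<Sum>j\<le>2*k. (-1) ^ j * qbin q (2*k) j) = (\<Prod>i<k. 1 - q ^ (2*i+1))"
  using assms
proof (induction k)
  case (Suc k)
  have "(\<Sum>j\<le>Suc (Suc (2*k)). (-1) ^ j * qbin q (Suc (Suc (2*k))) j)
      = (1 - q ^ Suc (2*k)) * (\<Sum>j\<le>2*k. (-1) ^ j * qbin q (2*k) j)"
    by (intro alternating_qbin_step Suc.prems) auto
  also have "(\<Sum>j\<le>2*k. (-1) ^ j * qbin q (2*k) j) = (\<Prod>i<k. 1 - q ^ (2*i+1))"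
    by (intro Suc.IH Suc.prems) auto
  finally show ?case
    by (simp add: mult.commute)
qed simp

lemma sum_shift_periodic:
  fixes g :: "nat \<Rightarrow> 'a::ab_group_add"
  assumes "\<And>j. g (j + p) = g j"
  shows "(\<Sum>j<p. g (j + s)) = (\<Sum>j<p. g j)"
proof (induction s)
  case (Suc s)
  have "(\<Sum>j<p. g (j + Suc s)) + g s = (\<Sum>j<Suc p. g (j + s))"
    by (subst sum.lessThan_Suc_shift) (simp add: add.commute)
  also have "\<dots> = (\<Sum>j<p. g (j + s)) + g s"
    using assms[of s] by (simp add: add.commute)
  finally show ?case
    using Suc.IH by simp
qed simp

text \<open>At \<open>q = inverse (w\<^sup>2)\<close> the signed coefficient of index
  \<open>j\<close> becomes \<open>w ^ (j * (j + 1))\<close>. Completing the square therefore turns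
  the quadratic sum into Gauss's alternating sum, whose product form is known.\<close>

lemma quadratic_sum_eq_prod:
  fixes w :: "'a::field"
  assumes p: "p = 2 * m + 1" and wp: "w ^ p = 1" and w: "\<And>i. i \<in> {1..<p} \<Longrightarrow> w ^ i \<noteq> 1"
  shows "(\<Sum>j<p. w ^ (j\<^sup>2)) = (\<Prod>i<m. w ^ (2*i+1) - inverse (w ^ (2*i+1)))"
proof -
  have w0: "w \<noteq> 0"
    using wp p by (auto simp: power_0_left)
  have winv: "w ^ a = w ^ b" if "a = b + p * c" for a b c
    using that wp by (simp add: power_add power_mult)
  define q where "q = inverse (w\<^sup>2)"
  have qp: "q ^ p = 1"
    unfolding q_def by (metis inverse_1 power_inverse power_mult mult.commute power_one wp)
  have q1: "q ^ i \<noteq> 1" if i: "i \<in> {1..2*m}" for i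
  proof
    assume "q ^ i = 1"
    hence *: "w ^ (2 * i) = 1"
      unfolding q_def by (simp add: power_inverse flip: power_mult)
    show False
    proof (cases "2 * i < p")
      case True
      thus False using w[of "2 * i"] * i by auto
    next
      case False
      have "w ^ (2 * i) = w ^ (2 * i - p)"
        using False by (intro winv[of _ _ 1]) simp
      moreover have "2 * i - p \<in> {1..<p}"
        using False i p by auto presburger
      ultimately show False
        using w * by auto
    qed
  qed
  have qbin: "(-1) ^ j * qbin q (2*m) j = w ^ (j * (j + 1))" if "j \<le> 2 * m" for j
    using that
  proof (induction j)
    case (Suc j)
    \<comment> \<open>The exponents add up to \<open>p\<close>. So the two powers are inverse to
      each other, and each new factor of the coefficient collapses to a single negated
      power.\<close>
    have "q ^ (2*m - j) * q ^ Suc j = 1"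
      using qp p Suc.prems by (simp del: power_Suc flip: power_add)
    hence e: "q ^ (2*m - j) = inverse (q ^ Suc j)"
      by (metis inverse_unique mult.commute)
    have nz: "q ^ Suc j \<noteq> 1"
      using q1[of "Suc j"] Suc.prems by auto
    have q0: "q ^ Suc j \<noteq> 0"
      using w0 by (simp add: q_def)
    have "(1 - q ^ (2*m - j)) / (1 - q ^ Suc j) = - inverse (q ^ Suc j)"
      unfolding e using nz q0 by (simp add: divide_simps del: power_Suc)
    also have "inverse (q ^ Suc j) = w ^ (2 * Suc j)"
      unfolding q_def power_inverse power_mult by simp
    finally have f: "(1 - q ^ (2*m - j)) / (1 - q ^ Suc j) = - (w ^ (2 * Suc j))" .
    have "(-1) ^ Suc j * qbin q (2*m) (Suc j) = ((-1) ^ j * qbin q (2*m) j) * w ^ (2 * Suc j)"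
      unfolding qbin_Suc f by simp
    also have "(-1) ^ j * qbin q (2*m) j = w ^ (j * (j + 1))"
      using Suc by simp
    also have "w ^ (j * (j + 1)) * w ^ (2 * Suc j) = w ^ (j * (j + 1) + 2 * Suc j)"
      by (simp only: power_add)
    also have "j * (j + 1) + 2 * Suc j = Suc j * (Suc j + 1)"
      by simp
    finally show ?case .
  qed simp
  define g where "g j = w ^ (j\<^sup>2)" for j
  have gper: "g (j + p) = g j" for j
    unfolding g_def by (rule winv[of _ _ "2 * j + p"]) (simp add: power2_eq_square algebra_simps)
  \<comment> \<open>The shift \<open>m + 1\<close> is the inverse of 2 modulo \<open>p\<close>:
    since \<open>2 * (m + 1) = p + 1\<close>, the square of \<open>j + (m + 1)\<close> is
    \<open>(m+1)\<^sup>2 + j * (j + 1) + p * j\<close>.\<close>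
  have "(\<Sum>j<p. w ^ (j\<^sup>2)) = (\<Sum>j<p. g (j + (m + 1)))"
    using sum_shift_periodic[of g p "m + 1"] gper by (simp add: g_def)
  also have "\<dots> = (\<Sum>j<p. w ^ ((m+1)\<^sup>2) * w ^ (j * (j + 1)))"
  proof (intro sum.cong refl)
    fix j
    show "g (j + (m + 1)) = w ^ ((m+1)\<^sup>2) * w ^ (j * (j + 1))"
      unfolding g_def power_add[symmetric]
      by (rule winv[of _ _ j]) (simp add: p power2_eq_square algebra_simps)
  qed
  also have "\<dots> = w ^ ((m+1)\<^sup>2) * (\<Sum>j\<le>2*m. (-1) ^ j * qbin q (2*m) j)"
    unfolding sum_distrib_left by (intro sum.cong) (auto simp: p qbin)
  also have "\<dots> = w ^ ((m+1)\<^sup>2) * (\<Prod>i<m. 1 - q ^ (2*i+1))"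
    by (subst alternating_qbin_sum) (use q1 in auto)
  \<comment> \<open>Here \<open>(m+1)\<^sup>2 = m\<^sup>2 + p\<close>, and \<open>m\<^sup>2\<close>
    is the sum of the first \<open>m\<close> odd numbers, so the prefactor can be distributed over
    the product, one odd power of \<open>w\<close> per factor.\<close>
  also have "w ^ ((m+1)\<^sup>2) = w ^ (m\<^sup>2)"
    by (rule winv[of _ _ 1]) (simp add: p power2_eq_square algebra_simps)
  also have "w ^ (m\<^sup>2) = (\<Prod>i<m. w ^ (2*i+1))"
  proof (induction m)
    case (Suc k)
    have "(Suc k)\<^sup>2 = k\<^sup>2 + (2 * k + 1)"
      by (simp add: power2_eq_square)
    thus ?case
      by (simp only: power_add[of w "k\<^sup>2"] prod.lessThan_Suc Suc)
  qed simp
  also have "(\<Prod>i<m. w ^ (2*i+1)) * (\<Prod>i<m. 1 - q ^ (2*i+1))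
      = (\<Prod>i<m. w ^ (2*i+1) * (1 - q ^ (2*i+1)))"
    by (simp only: prod.distrib)
  also have "\<dots> = (\<Prod>i<m. w ^ (2*i+1) - inverse (w ^ (2*i+1)))"
  proof (intro prod.cong refl)
    fix i
    have *: "z * (1 - inverse z * inverse z) = z - inverse z" if "z \<noteq> 0" for z :: 'a
      using that by (simp add: field_simps)
    have "q ^ (2*i+1) = inverse (w ^ (2*i+1)) * inverse (w ^ (2*i+1))"
      unfolding q_def power_inverse by (simp flip: power_mult power_add inverse_mult_distrib add: mult_2)
    thus "w ^ (2*i+1) * (1 - q ^ (2*i+1)) = w ^ (2*i+1) - inverse (w ^ (2*i+1))"
      by (simp only: *[OF power_not_zero[OF w0]])
  qed
  finally show ?thesis .
qed

lemma cis_power_neq_1: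
  assumes i: "i \<in> {1..<p}"
  shows "cis (2 * pi / real p) ^ i \<noteq> 1"
proof
  assume "cis (2 * pi / real p) ^ i = 1"
  hence "cis (2 * pi * (i / p)) = 1"
    by (simp add: DeMoivre algebra_simps)
  hence "cos (2 * pi * (i / p)) = 1"
    by (metis cis.sel(1) one_complex.sel(1))
  then obtain k :: int where "2 * pi * (i / p) = k * 2 * pi"
    by (auto simp: cos_one_2pi_int)
  hence "real i = k * real p"
    using i by (simp add: field_simps)
  hence "int i = k * int p"
    by (metis of_int_eq_iff of_int_mult of_int_of_nat_eq)
  thus False
    using i nat_dvd_not_less[of i p] by (auto simp flip: int_dvd_int_iff)
qed

text \<open>By the product formula every factor is \<open>\<i>\<close> times twice a real sine. As
  the modulus is given, only the number of negative sines has to be found.\<close>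

lemma gauss_sum_sign:
  assumes "odd p" and "p > 1"
    and norm: "norm (\<Sum>j<p. cis (2 * pi / p) ^ (j\<^sup>2)) = sqrt p"
  shows "(\<Sum>j<p. cis (2 * pi / p) ^ (j\<^sup>2)) = (if p mod 4 = 1 then 1 else \<i>) * sqrt p"
proof -
  define w where "w = cis (2 * pi / p)"
  define x where "x = 2 * pi / p"
  obtain m where m: "p = 2 * m + 1"
    using \<open>odd p\<close> by (elim oddE)
  have p0: "real p > 0"
    using \<open>p > 1\<close> by simp
  have wp: "w ^ p = 1"
    using p0 by (simp add: w_def DeMoivre)
  have w1: "w ^ i \<noteq> 1" if "i \<in> {1..<p}" for i
    using that unfolding w_def by (intro cis_power_neq_1)
  define s where "s i = sin (x * (2 * real i + 1))" for i
  \<comment> \<open>The sign of the sine: for \<open>2 * i + 1 \<le> m\<close> the angle is at most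
    \<open>pi\<close>, otherwise it lies between \<open>pi\<close> and \<open>2 * pi\<close>. The
    second case occurs for \<open>m div 2\<close> of the indices below \<open>m\<close>.\<close>
  define c where "c i = (if 2 * i + 1 \<le> m then 1 else -1 :: real)" for i
  have factor: "w ^ (2*i+1) - inverse (w ^ (2*i+1)) = \<i> * (2 * s i)" for i
  proof -
    have *: "w ^ (2*i+1) = cis (x * (2 * real i + 1))"
      unfolding w_def x_def DeMoivre by (simp add: algebra_simps)
    show ?thesis
      unfolding * by (simp add: s_def complex_eq_iff)
  qed
  have sgn: "s i = c i * \<bar>s i\<bar>" if "i < m" for i
  proof (cases "2 * i + 1 \<le> m")
    case True
    have "x * (2 * real i + 1) \<le> pi"
    proof -
      have "2 * (2 * real i + 1) \<le> real p"
        using True m by (simp flip: of_nat_le_iff[where ?'a = real])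
      hence "pi * (2 * (2 * real i + 1)) \<le> pi * real p"
        by (intro mult_left_mono) auto
      thus ?thesis using p0 by (simp add: x_def field_simps)
    qed
    moreover have "x \<ge> 0" using p0 by (simp add: x_def)
    ultimately have "s i \<ge> 0"
      unfolding s_def by (intro sin_ge_zero) auto
    thus ?thesis using True by (simp add: c_def)
  next
    case False
    have "p \<le> 2 * (2 * i + 1)" "2 * i + 1 < p"
      using False m that by auto
    hence "real p \<le> real (2 * (2 * i + 1))" "real (2 * i + 1) < real p"
      by (simp_all only: of_nat_le_iff of_nat_less_iff)
    hence "pi * real p \<le> pi * (2 * (2 * real i + 1))" "pi * (2 * real i + 1) < pi * real p"
      by simp_all
    hence "pi \<le> x * (2 * real i + 1)" "x * (2 * real i + 1) < 2 * pi"
      using p0 by (simp_all add: x_def field_simps)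
    hence "s i \<le> 0"
      unfolding s_def by (intro sin_le_zero)
    thus ?thesis using False by (simp add: c_def)
  qed
  have "(\<Prod>i<m. c i) = (\<Prod>i\<in>{(m+1) div 2..<m}. -1)"
    unfolding c_def by (rule prod.mono_neutral_cong_right) auto
  moreover have "m - (m + 1) div 2 = m div 2"
    by presburger
  ultimately have c: "(\<Prod>i<m. c i) = (-1) ^ (m div 2)"
    by (simp only: prod_constant card_atLeastLessThan)
  define A where "A = (\<Prod>i<m. 2 * \<bar>s i\<bar>)"
  have "(\<Sum>j<p. w ^ (j\<^sup>2)) = (\<Prod>i<m. \<i> * (2 * s i))"
    unfolding factor[symmetric] by (rule quadratic_sum_eq_prod[OF m wp w1])
  also have "\<dots> = (\<Prod>i<m. \<i> * (c i * (2 * \<bar>s i\<bar>)))"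
    by (intro prod.cong refl) (subst sgn, auto)
  also have "\<dots> = \<i> ^ m * (\<Prod>i<m. c i) * A"
    unfolding A_def by (simp add: prod.distrib)
  finally have G: "(\<Sum>j<p. w ^ (j\<^sup>2)) = \<i> ^ m * (-1) ^ (m div 2) * A"
    unfolding c by simp
  have "A \<ge> 0"
    unfolding A_def by (intro prod_nonneg) auto
  \<comment> \<open>The remaining factors have modulus one, so the nonnegative number
    \<open>A\<close> is the modulus of the sum.\<close>
  hence "A = sqrt p"
    using norm unfolding w_def[symmetric] G by (simp add: norm_mult norm_power)
  moreover have "\<i> ^ m * (-1) ^ (m div 2) = (if p mod 4 = 1 then 1 else \<i>)"
  proof (cases "even m")
    case True
    then obtain l where "m = 2 * l" by (elim evenE)
    thus ?thesis using m by (simp add: power_mult flip: power_mult_distrib)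
  next
    case False
    then obtain l where "m = 2 * l + 1" by (elim oddE)
    moreover from this have "p mod 4 = 3" using m by presburger
    ultimately show ?thesis by (simp add: power_mult flip: power_mult_distrib)
  qed
  ultimately show ?thesis
    using G by (simp add: w_def)
qed

subsection \<open>Subfields and traces\<close>

lemma card_le_mult_card_image:
  assumes "finite A" and "\<And>y. y \<in> f ` A \<Longrightarrow> card {x \<in> A. f x = y} \<le> k"
  shows "card A \<le> k * card (f ` A)"
proof -
  have "card A = (\<Sum>y\<in>f ` A. card {x \<in> A. f x = y})"
    using sum.image_gen[OF assms(1), of "\<lambda>_. 1::nat" f] by simp
  also have "\<dots> \<le> (\<Sum>y\<in>f ` A. k)"
    by (intro sum_mono assms)
  finally show ?thesis
    by (simp add: mult.commute)
qed

text \<open>Counts roots of \<open>X^m - a X - b\<close>. For \<open>m = 1\<close> the linear term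
  could cancel the leading one, which \<open>a = 0\<close> excludes. The case \<open>a = 1\<close>,
  \<open>b = 0\<close> concerns fixed points of Frobenius powers, the case \<open>a = 0\<close>,
  \<open>b = 1\<close> roots of unity.\<close>

lemma card_power_eq_linear_le:
  fixes a b :: "'a::{field,finite}"
  assumes "m > 0" and "m = 1 \<Longrightarrow> a = 0"
  shows "card {x. x ^ m = a * x + b} \<le> m"
proof -
  define P where "P = monom 1 m - [:b, a:]"
  have "coeff P m = 1"
    using assms by (cases m) (auto simp: P_def coeff_pCons split: nat.splits)
  hence "P \<noteq> 0"
    by auto
  have "degree P \<le> m"
    using assms unfolding P_def by (intro degree_diff_le) (auto simp: degree_monom_eq)
  moreover have "{x. x ^ m = a * x + b} = {x. poly P x = 0}"
    by (auto simp: P_def poly_monom algebra_simps)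
  ultimately show ?thesis
    using card_poly_roots_bound[OF \<open>P \<noteq> 0\<close>] by simp
qed

text \<open>A trace is a polynomial of degree \<open>p ^ (t * (m - 1))\<close>, so its kernel is
  small. This gives both the size of the subfields and the existence of elements of nonzero
  trace.\<close>

lemma card_frobenius_sum_kernel_le:
  fixes m t p :: nat
  assumes "m > 0" "t > 0" "p > 1"
  shows "card {x::'a::{field,finite}. (\<Sum>i<m. x ^ (p ^ (t * i))) = 0} \<le> p ^ (t * (m - 1))"
proof -
  define P :: "'a poly" where "P = (\<Sum>i<m. monom 1 (p ^ (t * i)))"
  have "coeff P (p ^ (t * (m - 1))) = (\<Sum>i<m. if i = m - 1 then 1 else 0)"
    unfolding P_def coeff_sum using assms by (intro sum.cong refl) (auto simp: power_inject_exp)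
  also have "\<dots> = 1"
    using assms by (subst sum.delta) auto
  finally have "P \<noteq> 0"
    by auto
  have "degree P \<le> p ^ (t * (m - 1))"
    unfolding P_def using assms
    by (intro degree_sum_le) (auto simp: degree_monom_eq intro!: power_increasing)
  moreover have "{x. (\<Sum>i<m. x ^ (p ^ (t * i))) = 0} = {x. poly P x = 0}"
    by (simp add: P_def poly_sum poly_monom)
  ultimately show ?thesis
    using card_poly_roots_bound[OF \<open>P \<noteq> 0\<close>] by simp
qed

lemma power_card_field:
  fixes x :: "'a::{field,finite}"
  shows "x ^ CARD('a) = x"
proof (cases "x = 0")
  case False
  have "(\<Prod>y\<in>UNIV-{0}. y) = (\<Prod>y\<in>UNIV-{0}. x * y)"
    using False by (intro prod.reindex_bij_witness[of _ "\<lambda>y. x * y" "\<lambda>y. y / x"]) auto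
  also have "\<dots> = x ^ (CARD('a) - 1) * (\<Prod>y\<in>UNIV-{0}. y)"
    by (simp add: prod.distrib)
  finally have "x ^ (CARD('a) - 1) = 1"
    by simp
  moreover have "x ^ CARD('a) = x * x ^ (CARD('a) - 1)"
    using finite_UNIV_card_ge_0[where ?'a = 'a] by (simp flip: power_Suc)
  ultimately show ?thesis
    by simp
qed simp

locale odd_finite_field =
  fixes p n :: nat and field_type :: "'a::{field,finite} itself"
  assumes p: "prime p" and odd_p: "odd p" and n: "n > 0" and card_UNIV: "CARD('a) = p ^ n"
begin

definition F :: "nat \<Rightarrow> 'a set" where
  "F t = subfield_of_order (p ^ t)"

abbreviation Tr :: "nat \<Rightarrow> 'a \<Rightarrow> 'a" where
  "Tr t \<equiv> ff_trace p t 1"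

abbreviation psi :: "nat \<Rightarrow> 'a \<Rightarrow> complex" where
  "psi t \<equiv> add_char p t 1"

lemma p_gt_1: "p > 1" and p_ge_3: "p \<ge> 3" and p_neq_0 [simp]: "p \<noteq> 0" and p_gt_0 [simp]: "p > 0"
proof -
  show *: "p > 1" using p by (rule prime_gt_1_nat)
  show "p \<ge> 3" using * odd_p by (cases "p = 2") auto
  show "p \<noteq> 0" "p > 0" using * by auto
qed

text \<open>Translating by 1 permutes the field, so summing all elements shows that
  \<open>p ^ n\<close> vanishes in it. The characteristic is thus a prime divisor of
  \<open>p ^ n\<close>.\<close>

lemma of_nat_eq_0_iff: "of_nat m = (0::'a) \<longleftrightarrow> p dvd m"
proof -
  have "(\<Sum>x\<in>UNIV. x + 1 :: 'a) = (\<Sum>x\<in>UNIV. x)"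
    by (rule sum.reindex_bij_witness[of _ "\<lambda>x. x - 1" "\<lambda>x. x + 1"]) auto
  hence "of_nat (p ^ n) = (0::'a)"
    by (simp add: sum.distrib card_UNIV)
  hence dvd: "CHAR('a) dvd p ^ n"
    using of_nat_eq_0_iff_char_dvd by blast
  have "prime CHAR('a)"
    by (intro prime_CHAR_semidom finite_imp_CHAR_pos) auto
  with dvd have "CHAR('a) = p"
    using p prime_dvd_power primes_dvd_imp_eq by blast
  thus ?thesis
    by (simp add: of_nat_eq_0_iff_char_dvd)
qed

lemma CHAR_eq: "CHAR('a) = p"
  using of_nat_eq_0_iff by (metis CHAR_eqI dvd_refl)

lemma two_nonzero [simp]: "(2::'a) \<noteq> 0"
proof -
  have "\<not> p dvd 2"
    using p_ge_3 by (auto dest: dvd_imp_le)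
  thus ?thesis
    using of_nat_eq_0_iff[of 2] by simp
qed

lemma one_neq_minus_one: "(1::'a) \<noteq> -1"
  using two_nonzero by (metis one_add_one add.right_inverse)

lemma frob_add: "(x + y :: 'a) ^ (p ^ k) = x ^ (p ^ k) + y ^ (p ^ k)"
  by (rule freshmans_dream'[where n = k]) (simp_all add: CHAR_eq p)

lemma frob_sum: "(\<Sum>i\<in>I. f i :: 'a) ^ (p ^ k) = (\<Sum>i\<in>I. f i ^ (p ^ k))"
  by (rule freshmans_dream_sum'[where n = k]) (simp_all add: CHAR_eq p)

lemma frob_minus: "(- x :: 'a) ^ (p ^ k) = - (x ^ (p ^ k))"
  using odd_p by simp

lemma frob_diff: "(x - y :: 'a) ^ (p ^ k) = x ^ (p ^ k) - y ^ (p ^ k)"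
  using frob_add[of x "-y" k] by (simp add: frob_minus)

lemma inj_frob: "inj (\<lambda>x::'a. x ^ (p ^ k))"
proof (rule injI)
  fix x y :: 'a assume "x ^ (p ^ k) = y ^ (p ^ k)"
  hence "(x - y) ^ (p ^ k) = 0"
    by (simp add: frob_diff)
  thus "x = y" by simp
qed

lemma in_F_iff: "x \<in> F t \<longleftrightarrow> x ^ (p ^ t) = x"
  by (simp add: F_def subfield_of_order_def)

lemma F_0 [simp]: "0 \<in> F t" and F_1 [simp]: "1 \<in> F t"
  and F_add [intro]: "x \<in> F t \<Longrightarrow> y \<in> F t \<Longrightarrow> x + y \<in> F t"
  and F_diff [intro]: "x \<in> F t \<Longrightarrow> y \<in> F t \<Longrightarrow> x - y \<in> F t"
  and F_minus [intro]: "x \<in> F t \<Longrightarrow> - x \<in> F t"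
  and F_mult [intro]: "x \<in> F t \<Longrightarrow> y \<in> F t \<Longrightarrow> x * y \<in> F t"
  and F_inverse [intro]: "x \<in> F t \<Longrightarrow> inverse x \<in> F t"
  and F_divide [intro]: "x \<in> F t \<Longrightarrow> y \<in> F t \<Longrightarrow> x / y \<in> F t"
  by (simp_all add: in_F_iff frob_add frob_diff frob_minus power_mult_distrib power_inverse power_divide)

lemma F_power [intro]: "x \<in> F t \<Longrightarrow> x ^ k \<in> F t"
  by (induction k) auto

lemma F_sum [intro]: "(\<And>i. i \<in> I \<Longrightarrow> f i \<in> F t) \<Longrightarrow> (\<Sum>i\<in>I. f i) \<in> F t"
  by (induction I rule: infinite_finite_induct) auto

lemma F_prod [intro]: "(\<And>i. i \<in> I \<Longrightarrow> f i \<in> F t) \<Longrightarrow> (\<Prod>i\<in>I. f i) \<in> F t"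
  by (induction I rule: infinite_finite_induct) auto

lemma F_of_nat [simp]: "of_nat k \<in> F t"
  by (induction k) auto

lemma F_2 [simp]: "2 \<in> F t"
  using F_of_nat[of 2 t] by simp

lemma frob_iterate: "x \<in> F t \<Longrightarrow> x ^ (p ^ (t * k)) = x"
  by (induction k) (simp_all add: power_add power_mult in_F_iff)

lemma frob_add_multiple: "x \<in> F t \<Longrightarrow> x ^ (p ^ (i + t * k)) = x ^ (p ^ i)"
  by (metis add.commute frob_iterate power_add power_mult)

lemma frob_mod: "x \<in> F t \<Longrightarrow> x ^ (p ^ (i mod t)) = x ^ (p ^ i)"
  using frob_add_multiple[of x t "i mod t" "i div t"] by simp

lemma F_mono: "s dvd t \<Longrightarrow> x \<in> F s \<Longrightarrow> x \<in> F t"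
  by (auto simp: in_F_iff[of _ t] frob_iterate elim!: dvdE)

lemma F_n [simp]: "x \<in> F n"
  using power_card_field[of x] by (simp add: in_F_iff card_UNIV)

lemma trace_add: "ff_trace p m k (x + y :: 'a) = ff_trace p m k x + ff_trace p m k y"
  by (simp add: ff_trace_def frob_add sum.distrib)

lemma trace_0 [simp]: "ff_trace p m k (0 :: 'a) = 0"
  by (simp add: ff_trace_def power_0_left)

lemma trace_minus: "ff_trace p m k (- x :: 'a) = - ff_trace p m k x"
  by (simp add: ff_trace_def frob_minus sum_negf)

lemma trace_diff: "ff_trace p m k (x - y :: 'a) = ff_trace p m k x - ff_trace p m k y"
  by (simp add: ff_trace_def frob_diff sum_subtractf)

lemma trace_sum: "ff_trace p m k (\<Sum>i\<in>I. f i :: 'a) = (\<Sum>i\<in>I. ff_trace p m k (f i))"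
  by (induction I rule: infinite_finite_induct) (simp_all add: trace_add)

lemma trace_scale:
  assumes "z \<in> F k"
  shows "ff_trace p m k (z * x :: 'a) = z * ff_trace p m k x"
  using assms unfolding ff_trace_def
  by (simp add: power_mult_distrib frob_iterate sum_distrib_left)

lemma trace_in_F:
  assumes "k dvd t" "x \<in> F t" "t > 0"
  shows "ff_trace p t k x \<in> F k"
proof -
  define m where "m = t div k"
  have t: "t = k * m"
    using assms(1) by (simp add: m_def)
  hence "m > 0"
    using assms(3) by (cases m) auto
  define g where "g i = x ^ (p ^ (k * i))" for i
  have "g m = g 0"
    using assms(2) t by (simp add: g_def in_F_iff)
  have "(\<Sum>i<m. g i) ^ (p ^ k) = (\<Sum>i<m. g (Suc i))"
    unfolding frob_sum g_def by (simp flip: power_mult power_add add: add.commute mult.commute)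
  also have "\<dots> = (\<Sum>i<m. g i)"
    using sum.lessThan_Suc_shift[of g m] \<open>g m = g 0\<close> by simp
  finally show ?thesis
    by (simp add: in_F_iff ff_trace_def g_def m_def)
qed

text \<open>The Frobenius exponents below \<open>n\<close> are cut into blocks of length
  \<open>t\<close>; within block \<open>i\<close> they are \<open>i * t + j\<close> with
  \<open>j < t\<close>.\<close>

lemma trace_trans:
  assumes "t dvd n"
  shows "Tr n (x::'a) = Tr t (ff_trace p n t x)"
proof -
  define m where "m = n div t"
  have n_eq: "n = m * t"
    using assms by (simp add: m_def)
  have "Tr n x = (\<Sum>i<m. \<Sum>j\<in>{i*t..<i*t+t}. x ^ (p ^ j))"
    unfolding ff_trace_def by (simp add: sum.nat_group n_eq)
  also have "\<dots> = (\<Sum>i<m. \<Sum>j<t. (x ^ (p ^ (t * i))) ^ (p ^ j))"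
  proof (rule sum.cong[OF refl])
    fix i
    show "(\<Sum>j\<in>{i*t..<i*t+t}. x ^ (p ^ j)) = (\<Sum>j<t. (x ^ (p ^ (t * i))) ^ (p ^ j))"
      by (rule sum.reindex_bij_witness[of _ "\<lambda>j. i * t + j" "\<lambda>j. j - i * t"])
         (auto simp: algebra_simps simp flip: power_mult power_add)
  qed
  also have "\<dots> = Tr t (ff_trace p n t x)"
    unfolding ff_trace_def by (subst sum.swap) (simp add: frob_sum m_def)
  finally show ?thesis .
qed

text \<open>The upper bound counts roots. For the lower bound, the trace maps the whole field into
  \<open>F t\<close>, and each fibre is a translate of a kernel with at most
  \<open>p ^ (t * (m - 1))\<close> elements, so at least \<open>p ^ t\<close> values occur.\<close>

lemma card_F:
  assumes "t dvd n" "t > 0"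
  shows "card (F t) = p ^ t"
proof (rule antisym)
  have "p ^ t > 1"
    using p_gt_1 assms(2) by (rule one_less_power)
  have "F t = {x. x ^ (p ^ t) = 1 * x + 0}"
    by (simp add: F_def subfield_of_order_def)
  thus "card (F t) \<le> p ^ t"
    using card_power_eq_linear_le[of "p ^ t" 1 "0::'a"] \<open>p ^ t > 1\<close> by fastforce
next
  define m where "m = n div t"
  have n_eq: "n = t * m"
    using assms by (simp add: m_def)
  hence "m > 0"
    using n by (cases m) auto
  have ker: "card {x::'a. ff_trace p n t x = 0} \<le> p ^ (t * (m - 1))"
    using card_frobenius_sum_kernel_le[OF \<open>m > 0\<close> assms(2) p_gt_1, where ?'a = 'a]
    by (simp add: ff_trace_def m_def)
  have "card (UNIV :: 'a set) \<le> p ^ (t * (m - 1)) * card (range (ff_trace p n t :: 'a \<Rightarrow> 'a))"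
  proof (rule card_le_mult_card_image)
    fix y :: 'a assume "y \<in> range (ff_trace p n t)"
    then obtain z where z: "y = ff_trace p n t z" by auto
    have "card {x \<in> UNIV. ff_trace p n t x = y} = card {x::'a. ff_trace p n t x = 0}"
      by (rule bij_betw_same_card[of "\<lambda>x. x - z"], rule bij_betw_byWitness[of _ "\<lambda>x. x + z"])
         (auto simp: z trace_diff trace_add)
    thus "card {x \<in> UNIV. ff_trace p n t x = y} \<le> p ^ (t * (m - 1))"
      using ker by simp
  qed simp
  also have "\<dots> \<le> p ^ (t * (m - 1)) * card (F t)"
    using assms n by (intro mult_left_mono card_mono) (auto intro!: trace_in_F)
  also have "card (UNIV :: 'a set) = p ^ (t * (m - 1)) * p ^ t"
    using \<open>m > 0\<close> by (simp add: card_UNIV n_eq flip: power_add) (metis Suc_pred mult_Suc_right add.commute)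
  finally show "p ^ t \<le> card (F t)"
    by simp
qed

lemma F1_eq: "F 1 = of_nat ` {..<p}"
proof (rule sym, rule card_subset_eq)
  have "inj_on (of_nat :: nat \<Rightarrow> 'a) {..<p}"
  proof (rule linorder_inj_onI)
    fix x y assume xy: "x < y" "y \<in> {..<p}"
    hence "\<not> p dvd y - x"
      by (auto dest: dvd_imp_le)
    thus "of_nat x \<noteq> (of_nat y :: 'a)"
      using of_nat_eq_0_iff[of "y - x"] xy by (simp add: of_nat_diff)
  qed auto
  hence "card (of_nat ` {..<p} :: 'a set) = p"
    by (simp add: card_image)
  thus "card (of_nat ` {..<p} :: 'a set) = card (F 1)"
    using card_F[of 1] by simp
qed auto

end

subsection \<open>Characters\<close>

declare One_nat_def [simp del]

text \<open>If \<open>f h\<close> differs from 1, translating by \<open>h\<close> multiplies the sum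
  by \<open>f h\<close> without changing it, so the sum is zero.\<close>

lemma subgroup_character_sum:
  fixes f :: "'a::ab_group_add \<Rightarrow> complex"
  assumes H: "finite H" "\<And>x y. x \<in> H \<Longrightarrow> y \<in> H \<Longrightarrow> x + y \<in> H" "\<And>x y. x \<in> H \<Longrightarrow> y \<in> H \<Longrightarrow> x - y \<in> H"
    and f: "\<And>x y. x \<in> H \<Longrightarrow> y \<in> H \<Longrightarrow> f (x + y) = f x * f y"
  shows "(\<Sum>x\<in>H. f x) = (if \<forall>x\<in>H. f x = 1 then of_nat (card H) else 0)"
proof (cases "\<forall>x\<in>H. f x = 1")
  case False
  then obtain h where h: "h \<in> H" "f h \<noteq> 1"
    by auto
  have "(\<Sum>x\<in>H. f x) = (\<Sum>x\<in>H. f (x + h))"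
    by (rule sum.reindex_bij_witness[of _ "\<lambda>x. x + h" "\<lambda>x. x - h"]) (use H h in auto)
  also have "\<dots> = f h * (\<Sum>x\<in>H. f x)"
    unfolding sum_distrib_left using f h by (intro sum.cong refl) (simp add: mult.commute)
  finally have "(1 - f h) * (\<Sum>x\<in>H. f x) = 0"
    by (simp add: algebra_simps)
  thus ?thesis
    using h False by auto
qed simp

context odd_finite_field
begin

text \<open>The additive character of the prime field through which all characters
  \<open>add_char\<close> factor after taking the trace. It is meaningful on \<open>F 1\<close>
  only.\<close>

definition e :: "'a \<Rightarrow> complex" where
  "e y = exp (2 * of_real pi * \<i> * of_nat (prime_field_val p y) / of_nat p)"

lemma psi_eq: "psi t y = e (Tr t y)"
  by (simp add: add_char_def e_def)

lemma add_char_eq: "add_char p n c y = e (Tr n (c * y))"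
  by (simp add: add_char_def e_def)

lemma zeta_power_p: "cis (2 * pi / real p) ^ p = 1"
  by (simp add: DeMoivre)

text \<open>Since \<open>p\<close> vanishes in the field and the root of unity has order dividing
  \<open>p\<close>, any natural representative may replace the one below \<open>p\<close>.
  Additivity of \<open>e\<close> then reduces to adding exponents.\<close>

lemma e_of_nat: "e (of_nat m) = cis (2 * pi / real p) ^ m"
proof -
  have inj: "i = j" if "i < p" "j < p" "of_nat i = (of_nat j :: 'a)" for i j
  proof -
    have "p dvd j - i" "p dvd i - j"
      using that by (cases "i \<le> j"; simp add: of_nat_diff flip: of_nat_eq_0_iff)+
    thus ?thesis
      using that by (metis diff_is_0_eq dvd_imp_le le_antisym less_imp_diff_less linorder_not_less neq0_conv)
  qed
  have m: "of_nat m = (of_nat (m mod p) :: 'a)"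
  proof -
    have "(of_nat (m mod p + p * (m div p)) :: 'a) = of_nat (m mod p)"
      unfolding of_nat_add of_nat_mult using of_nat_eq_0_iff[of p] by simp
    thus ?thesis by simp
  qed
  have val: "prime_field_val p (of_nat m :: 'a) = m mod p"
    unfolding prime_field_val_def m using inj by (intro the_equality) auto
  have "e (of_nat m) = cis (2 * pi / real p) ^ (m mod p)"
    unfolding e_def val DeMoivre unfolding cis_conv_exp by (simp add: mult_ac)
  also have "\<dots> = cis (2 * pi / real p) ^ (m mod p + p * (m div p))"
    unfolding power_add power_mult zeta_power_p by simp
  finally show ?thesis by simp
qed

lemma e_0 [simp]: "e 0 = 1"
  using e_of_nat[of 0] by simp

lemma e_add: "x \<in> F 1 \<Longrightarrow> y \<in> F 1 \<Longrightarrow> e (x + y) = e x * e y"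
  unfolding F1_eq by (auto simp: e_of_nat power_add simp flip: of_nat_add)

lemma e_eq_1_iff:
  assumes "x \<in> F 1"
  shows "e x = 1 \<longleftrightarrow> x = 0"
proof -
  obtain m where m: "m < p" "x = of_nat m"
    using assms unfolding F1_eq by auto
  have "x = 0 \<longleftrightarrow> m = 0"
    using m of_nat_eq_0_iff[of m] by (auto dest: dvd_imp_le)
  thus ?thesis
    using m cis_power_neq_1[of m p] by (cases "m = 0") (auto simp: e_of_nat)
qed

lemma cnj_e:
  assumes "x \<in> F 1"
  shows "cnj (e x) = e (- x)"
proof -
  have "e x * e (- x) = 1"
    using e_add[of x "-x"] assms by auto
  moreover obtain m where "x = of_nat m"
    using assms unfolding F1_eq by auto
  hence "e x * cnj (e x) = 1"
    by (simp add: e_of_nat complex_norm_square[symmetric] norm_power del: complex_cnj_power)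
  ultimately show ?thesis
    by (metis mult_cancel_left mult_zero_left zero_neq_one)
qed

lemma gauss_sum_F1: "(\<Sum>x\<in>F 1. e (x\<^sup>2)) = (\<Sum>j<p. cis (2 * pi / real p) ^ (j\<^sup>2))"
proof -
  have "card (of_nat ` {..<p} :: 'a set) = card {..<p}"
    using card_F[of 1] by (simp add: F1_eq)
  hence "inj_on (of_nat :: nat \<Rightarrow> 'a) {..<p}"
    by (intro eq_card_imp_inj_on) auto
  thus ?thesis
    unfolding F1_eq by (simp add: sum.reindex flip: e_of_nat)
qed

end

locale odd_finite_subfield = odd_finite_field p n field_type
  for p n and field_type :: "'a::{field,finite} itself" +
  fixes t :: nat
  assumes t_dvd: "t dvd n" and t_pos [simp]: "t > 0"
begin

lemma Tr_in_F1: "x \<in> F t \<Longrightarrow> Tr t x \<in> F 1"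
  by (intro trace_in_F) auto

lemma psi_add: "x \<in> F t \<Longrightarrow> y \<in> F t \<Longrightarrow> psi t (x + y) = psi t x * psi t y"
  by (simp add: psi_eq trace_add e_add Tr_in_F1)

lemma psi_0 [simp]: "psi t 0 = 1"
  by (simp add: psi_eq)

lemma cnj_psi: "x \<in> F t \<Longrightarrow> cnj (psi t x) = psi t (- x)"
  by (simp add: psi_eq trace_minus cnj_e Tr_in_F1)

lemma psi_eq_1_iff: "x \<in> F t \<Longrightarrow> psi t x = 1 \<longleftrightarrow> Tr t x = 0"
  by (simp add: psi_eq e_eq_1_iff Tr_in_F1)

lemma card_Ft: "card (F t) = p ^ t"
  using t_dvd by (intro card_F) auto

text \<open>The kernel of the trace has at most \<open>p ^ (t - 1)\<close> elements, too few to
  contain \<open>F t\<close>. An element \<open>y\<close> of nonzero trace gives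
  \<open>y / u\<close> as a witness that the character is nontrivial.\<close>

lemma psi_sum:
  assumes u: "u \<in> F t"
  shows "(\<Sum>y\<in>F t. psi t (u * y)) = (if u = 0 then of_nat (p ^ t) else 0)"
proof (cases "u = 0")
  case False
  have "card {x::'a. Tr t x = 0} \<le> p ^ (t - 1)"
    using card_frobenius_sum_kernel_le[of t 1 p, where ?'a = 'a] p_gt_1 by (simp add: ff_trace_def)
  also have "\<dots> < card (F t)"
    unfolding card_Ft using p_gt_1 by (intro power_strict_increasing) auto
  finally have "\<not> F t \<subseteq> {x::'a. Tr t x = 0}"
    using card_mono[of "{x::'a. Tr t x = 0}" "F t"] by auto
  then obtain y where y: "y \<in> F t" "Tr t y \<noteq> 0"
    by auto
  have "psi t (u * (y / u)) \<noteq> 1" "y / u \<in> F t"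
    using y u False by (auto simp: psi_eq_1_iff)
  moreover have "(\<Sum>y\<in>F t. psi t (u * y)) = (if \<forall>y\<in>F t. psi t (u * y) = 1 then of_nat (card (F t)) else 0)"
    by (rule subgroup_character_sum) (use u in \<open>auto simp: psi_add distrib_left F_mult\<close>)
  ultimately show ?thesis
    using False by auto
qed (simp add: card_Ft)

section \<open>The quadratic character of \<open>F t\<close>\<close>

abbreviation chi :: "'a \<Rightarrow> int" where
  "chi \<equiv> quad_char (p ^ t)"

definition h :: nat where
  "h = (p ^ t - 1) div 2"

lemma two_h: "2 * h = p ^ t - 1" and h_pos: "h > 0"
proof -
  have "odd (p ^ t)"
    using odd_p by simp
  moreover have "p ^ t > 1"
    using p_gt_1 by (intro one_less_power) auto
  ultimately show "2 * h = p ^ t - 1" "h > 0"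
    unfolding h_def by presburger+
qed

lemma power_eq_1:
  assumes "x \<in> F t" "x \<noteq> 0"
  shows "x ^ (p ^ t - 1) = 1"
proof -
  have "x * x ^ (p ^ t - 1) = x"
    using assms(1) by (simp add: in_F_iff flip: power_Suc)
  thus ?thesis
    using assms(2) by simp
qed

lemma square_root_set: "z \<in> F t \<Longrightarrow> {x \<in> F t. x\<^sup>2 = z\<^sup>2} = {z, - z}"
  by (auto simp: power2_eq_iff)

text \<open>Squaring is at most two-to-one, so there are at least \<open>h\<close> nonzero squares.
  All of them are roots of \<open>y ^ h = 1\<close>, which has at most \<open>h\<close> roots, so
  the two sets agree. A nonsquare has \<open>u ^ h = -1\<close> because the square of
  \<open>u ^ h\<close> is 1.\<close>

lemma euler_criterion:
  assumes u: "u \<in> F t" "u \<noteq> 0"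
  shows "u ^ h = of_int (chi u)"
proof -
  define Sq where "Sq = (\<lambda>x. x\<^sup>2) ` (F t - {0})"
  have "card (F t - {0}) \<le> 2 * card Sq"
    unfolding Sq_def
  proof (rule card_le_mult_card_image)
    fix y :: 'a assume "y \<in> (\<lambda>x. x\<^sup>2) ` (F t - {0})"
    then obtain z where z: "z \<in> F t" "y = z\<^sup>2"
      by auto
    have "card {x \<in> F t - {0}. x\<^sup>2 = y} \<le> card {z, - z}"
      using square_root_set[OF z(1)] z by (intro card_mono) auto
    thus "card {x \<in> F t - {0}. x\<^sup>2 = y} \<le> 2"
      by (rule order_trans) (simp add: card_insert_if)
  qed simp
  hence "h \<le> card Sq"
    using two_h by (simp add: card_Ft)
  moreover have "card {y::'a. y ^ h = 1} \<le> h"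
    using card_power_eq_linear_le[of h 0 "1::'a"] h_pos by simp
  moreover have "Sq \<subseteq> {y. y ^ h = 1}"
    by (auto simp: Sq_def power_eq_1 two_h simp flip: power_mult)
  ultimately have Sq: "Sq = {y. y ^ h = 1}"
    using card_mono[of "{y. y ^ h = 1}" Sq] by (intro card_subset_eq) auto
  show ?thesis
  proof (cases "\<exists>z\<in>F t. z\<^sup>2 = u")
    case True
    hence "u \<in> Sq"
      using u(2) by (auto simp: Sq_def)
    thus ?thesis
      using True u unfolding Sq by (auto simp: quad_char_def F_def)
  next
    case False
    hence "u \<notin> Sq"
      by (auto simp: Sq_def)
    hence "u ^ h \<noteq> 1"
      unfolding Sq by simp
    moreover have "(u ^ h)\<^sup>2 = u ^ (2 * h)"
      by (simp add: mult.commute flip: power_mult)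
    hence "(u ^ h)\<^sup>2 = 1"
      using power_eq_1[OF u] by (simp add: two_h)
    ultimately have "u ^ h = -1"
      by (simp add: power2_eq_1_iff)
    thus ?thesis
      using False u by (auto simp: quad_char_def F_def)
  qed
qed

lemma chi_cases: "u \<noteq> 0 \<Longrightarrow> chi u = 1 \<or> chi u = -1"
  by (simp add: quad_char_def)

lemma chi_0 [simp]: "chi 0 = 0"
  by (simp add: quad_char_def)

lemma of_int_sign_inj:
  "of_int a = (of_int b :: 'a) \<Longrightarrow> a = 1 \<or> a = -1 \<Longrightarrow> b = 1 \<or> b = -1 \<Longrightarrow> a = b"
  using one_neq_minus_one one_neq_minus_one[symmetric] by (elim disjE) simp_all

text \<open>The integers 1 and -1 stay distinct in odd characteristic, so the value of
  \<open>chi\<close> can be read off in the field, where Euler's criterion makes it a power.\<close>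

lemma chi_eqI:
  assumes "u \<in> F t" "u \<noteq> 0" "u ^ h = of_int a" "a = 1 \<or> a = -1"
  shows "chi u = a"
  using of_int_sign_inj[of "chi u" a] chi_cases[of u] euler_criterion[of u] assms by auto

lemma chi_mult:
  assumes "u \<in> F t" "v \<in> F t"
  shows "chi (u * v) = chi u * chi v"
proof (cases "u = 0 \<or> v = 0")
  case False
  thus ?thesis
    using assms chi_cases[of u] chi_cases[of v]
    by (intro chi_eqI) (auto simp: power_mult_distrib euler_criterion)
qed auto

lemma chi_square:
  assumes "u \<noteq> 0"
  shows "chi u * chi u = 1"
  using chi_cases[OF assms] by auto

lemma chi_1 [simp]: "chi 1 = 1"
  by (rule chi_eqI) auto

lemma chi_power: "u \<in> F t \<Longrightarrow> chi (u ^ k) = chi u ^ k"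
  by (induction k) (auto simp: chi_mult F_power)

lemma chi_prod: "(\<And>i. i \<in> I \<Longrightarrow> f i \<in> F t) \<Longrightarrow> chi (\<Prod>i\<in>I. f i) = (\<Prod>i\<in>I. chi (f i))"
  by (induction I rule: infinite_finite_induct) (auto simp: chi_mult F_prod)

lemma chi_inverse:
  assumes "u \<in> F t" "u \<noteq> 0"
  shows "chi (inverse u) = chi u"
proof -
  have "chi u * chi (inverse u) = 1"
    using chi_mult[of u "inverse u"] assms by auto
  thus ?thesis
    using chi_cases[of u] assms by auto
qed

lemma chi_minus_1: "chi (-1) = (-1) ^ h"
proof (rule chi_eqI)
  show "(-1) ^ h = (of_int ((-1) ^ h) :: 'a)"
    by simp
  show "(-1) ^ h = (1::int) \<or> (-1) ^ h = (-1::int)"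
    by (simp add: minus_one_power_iff)
qed auto

lemma card_square_roots:
  assumes "v \<in> F t"
  shows "int (card {x \<in> F t. x\<^sup>2 = v}) = 1 + chi v"
proof (cases "\<exists>z\<in>F t. z\<^sup>2 = v")
  case True
  then obtain z where z: "z \<in> F t" "v = z\<^sup>2"
    by auto
  show ?thesis
  proof (cases "z = 0")
    case True
    have "{x \<in> F t. x\<^sup>2 = 0} = {0 :: 'a}"
      by auto
    thus ?thesis
      using z True by simp
  next
    case False
    have "z \<noteq> - z"
    proof
      assume "z = - z"
      hence "2 * z = 0"
        by (simp only: mult_2 eq_neg_iff_add_eq_0)
      thus False
        using False by simp
    qed
    hence "card {x \<in> F t. x\<^sup>2 = v} = 2"
      unfolding z(2) square_root_set[OF z(1)] by simp
    moreover have "chi v = 1"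
      using False z by (auto simp: quad_char_def F_def)
    ultimately show ?thesis by simp
  qed
next
  case False
  hence "{x \<in> F t. x\<^sup>2 = v} = {}" "v \<noteq> 0"
    by (auto simp: power2_eq_square)
  moreover have "chi v = -1"
    using False calculation by (auto simp: quad_char_def F_def)
  ultimately show ?thesis by simp
qed

section \<open>Quadratic sums over \<open>F t\<close>\<close>

definition S :: "'a \<Rightarrow> complex" where
  "S u = (\<Sum>x\<in>F t. psi t (u * x\<^sup>2))"

text \<open>Grouping by \<open>y = x\<^sup>2\<close> weights each \<open>y\<close> with its number
  \<open>1 + chi y\<close> of square roots; the part coming from 1 is a full character sum and
  vanishes.\<close>

lemma S_eq_chi_sum:
  assumes u: "u \<in> F t" "u \<noteq> 0"
  shows "S u = (\<Sum>y\<in>F t. psi t (u * y) * of_int (chi y))"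
proof -
  have "S u = (\<Sum>y\<in>F t. \<Sum>x\<in>{x \<in> F t. x\<^sup>2 = y}. psi t (u * x\<^sup>2))"
    unfolding S_def by (rule sum.group[symmetric]) auto
  also have "\<dots> = (\<Sum>y\<in>F t. psi t (u * y) * of_int (int (card {x \<in> F t. x\<^sup>2 = y})))"
    by (intro sum.cong refl) simp
  also have "\<dots> = (\<Sum>y\<in>F t. psi t (u * y)) + (\<Sum>y\<in>F t. psi t (u * y) * of_int (chi y))"
    unfolding sum.distrib[symmetric] by (intro sum.cong refl) (simp add: card_square_roots distrib_left del: of_int_of_nat_eq)
  finally show ?thesis
    using psi_sum[OF u(1)] u(2) by simp
qed

lemma S_eq_chi_times:
  assumes u: "u \<in> F t" "u \<noteq> 0"
  shows "S u = of_int (chi u) * S 1"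
proof -
  have "S u = (\<Sum>y\<in>F t. psi t y * of_int (chi (y / u)))"
    unfolding S_eq_chi_sum[OF u]
    by (rule sum.reindex_bij_witness[of _ "\<lambda>y. y / u" "\<lambda>y. u * y"]) (use u in auto)
  also have "\<dots> = (\<Sum>y\<in>F t. of_int (chi u) * (psi t (1 * y) * of_int (chi y)))"
    using u by (intro sum.cong refl) (simp add: divide_inverse chi_mult chi_inverse F_inverse)
  also have "\<dots> = of_int (chi u) * S 1"
    by (subst S_eq_chi_sum) (simp_all add: sum_distrib_left)
  finally show ?thesis .
qed

text \<open>In the double sum for \<open>S 1 * cnj (S 1)\<close>, the substitution
  \<open>x = y + d\<close> leaves an exponent linear in \<open>y\<close>. Orthogonality keeps only
  \<open>2 * d = 0\<close>, hence \<open>d = 0\<close>.\<close>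

lemma norm_S_1: "norm (S 1) = sqrt (real p ^ t)"
proof -
  have "S 1 * cnj (S 1) = (\<Sum>y\<in>F t. \<Sum>x\<in>F t. psi t (x\<^sup>2) * psi t (- (y\<^sup>2)))"
    unfolding S_def cnj_sum sum_product by (subst sum.swap) (simp add: cnj_psi F_power)
  also have "\<dots> = (\<Sum>y\<in>F t. \<Sum>d\<in>F t. psi t ((y + d)\<^sup>2) * psi t (- (y\<^sup>2)))"
  proof (rule sum.cong[OF refl])
    fix y assume "y \<in> F t"
    thus "(\<Sum>x\<in>F t. psi t (x\<^sup>2) * psi t (- (y\<^sup>2))) = (\<Sum>d\<in>F t. psi t ((y + d)\<^sup>2) * psi t (- (y\<^sup>2)))"
      by (intro sum.reindex_bij_witness[of _ "\<lambda>d. y + d" "\<lambda>x. x - y"]) auto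
  qed
  also have "\<dots> = (\<Sum>y\<in>F t. \<Sum>d\<in>F t. psi t (d\<^sup>2) * psi t ((2 * d) * y))"
  proof (rule sum.cong[OF refl], rule sum.cong[OF refl])
    fix y d assume yd: "y \<in> F t" "d \<in> F t"
    have F: "(y + d)\<^sup>2 \<in> F t" "- (y\<^sup>2) \<in> F t" "d\<^sup>2 \<in> F t" "2 * d * y \<in> F t"
      using yd by (auto intro!: F_power F_mult F_2)
    have "(y + d)\<^sup>2 + - (y\<^sup>2) = d\<^sup>2 + 2 * d * y"
      by (simp add: power2_sum)
    thus "psi t ((y + d)\<^sup>2) * psi t (- (y\<^sup>2)) = psi t (d\<^sup>2) * psi t ((2 * d) * y)"
      using F by (simp only: psi_add[symmetric])
  qed
  also have "\<dots> = (\<Sum>d\<in>F t. psi t (d\<^sup>2) * (\<Sum>y\<in>F t. psi t ((2 * d) * y)))"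
    by (subst sum.swap) (simp add: sum_distrib_left)
  also have "\<dots> = (\<Sum>d\<in>F t. if d = 0 then of_nat (p ^ t) else 0)"
  proof (rule sum.cong[OF refl])
    fix d assume "d \<in> F t"
    hence "2 * d \<in> F t"
      by (intro F_mult F_2)
    thus "psi t (d\<^sup>2) * (\<Sum>y\<in>F t. psi t ((2 * d) * y)) = (if d = 0 then of_nat (p ^ t) else 0)"
      by (subst psi_sum) simp_all
  qed
  also have "\<dots> = of_nat (p ^ t)"
    by simp
  finally have "complex_of_real ((norm (S 1))\<^sup>2) = complex_of_real (real p ^ t)"
    unfolding complex_norm_square by simp
  hence "(norm (S 1))\<^sup>2 = real p ^ t"
    unfolding of_real_eq_iff .
  thus ?thesis
    by (metis norm_ge_zero real_sqrt_unique)
qed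

end

subsection \<open>Evaluation of the quadratic Gauss sum\<close>

lemma prod_linear_factors:
  fixes B :: "'a::field set"
  assumes "finite B"
  shows "degree (\<Prod>b\<in>B. [:- b, 1:]) = card B \<and> coeff (\<Prod>b\<in>B. [:- b, 1:]) (card B) = 1"
proof -
  have "degree (\<Prod>b\<in>B. [:- b, 1:]) = card B"
    by (subst degree_prod_eq_sum_degree) auto
  moreover have "lead_coeff (\<Prod>b\<in>B. [:- b, 1:]) = 1"
    by (simp add: lead_coeff_prod)
  ultimately show ?thesis by simp
qed

text \<open>Euler's formula. Lagrange interpolation at the nodes \<open>A\<close> reproduces the
  monomial of degree \<open>k < card A\<close>; the claim compares the coefficients of degree
  \<open>card A - 1\<close>.\<close>

lemma lagrange_power_sum:
  fixes A :: "'a::field set"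
  assumes A: "finite A" and k: "k < card A"
  shows "(\<Sum>a\<in>A. a ^ k / (\<Prod>b\<in>A - {a}. a - b)) = (if k = card A - 1 then 1 else 0)"
proof -
  define L where "L a = (\<Prod>b\<in>A - {a}. [:- b, 1:])" for a
  define w where "w a = a ^ k / (\<Prod>b\<in>A - {a}. a - b)" for a
  define P where "P = (\<Sum>a\<in>A. smult (w a) (L a))"
  have L: "degree (L a) = card A - 1" "coeff (L a) (card A - 1) = 1" if "a \<in> A" for a
    using prod_linear_factors[of "A - {a}"] that A by (simp_all add: L_def)
  have "P = monom 1 k"
  proof (rule poly_eqI_degree)
    fix c assume c: "c \<in> A"
    have "poly P c = (\<Sum>a\<in>A. if a = c then c ^ k else 0)"
      unfolding P_def poly_sum
    proof (intro sum.cong refl)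
      fix a assume a: "a \<in> A"
      show "poly (smult (w a) (L a)) c = (if a = c then c ^ k else 0)"
      proof (cases "a = c")
        case True
        have "(\<Prod>b\<in>A - {c}. c - b) \<noteq> 0"
          using A by auto
        thus ?thesis
          using True by (simp add: w_def L_def poly_prod)
      next
        case False
        hence "poly (L a) c = 0"
          using A c by (auto simp: L_def poly_prod)
        thus ?thesis using False by simp
      qed
    qed
    thus "poly P c = poly (monom 1 k) c"
      using A c by (simp add: poly_monom)
  next
    have "degree P \<le> card A - 1"
      unfolding P_def using A L by (intro degree_sum_le order_trans[OF degree_smult_le]) auto
    thus "degree P < card A"
      using k by simp
    show "degree (monom (1::'a) k) < card A"
      using k by (simp add: degree_monom_eq)
  qed
  hence "coeff P (card A - 1) = (if k = card A - 1 then 1 else 0)"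
    by (simp add: eq_commute)
  moreover have "coeff P (card A - 1) = (\<Sum>a\<in>A. w a)"
    unfolding P_def coeff_sum by (intro sum.cong refl) (simp add: L)
  ultimately show ?thesis
    by (simp add: w_def)
qed

text \<open>The involution taking \<open>i\<close> to \<open>t - i\<close> pairs the indices; for
  even \<open>t\<close> its fixed point \<open>t div 2\<close> is left over.\<close>

lemma prod_pair_up:
  fixes g :: "nat \<Rightarrow> 'b::comm_monoid_mult"
  assumes "t > 0"
  shows "(\<Prod>i\<in>{1..<t}. g i)
       = (\<Prod>i\<in>{1..<(t + 1) div 2}. g i * g (t - i)) * (if even t then g (t div 2) else 1)"
proof -
  define B where "B = {1..<(t + 1) div 2}"
  define C where "C = {t div 2 + 1..<t}"
  define M where "M = (if even t then {t div 2} else {})"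
  have "{1..<t} = (B \<union> C) \<union> M"
    using assms unfolding B_def C_def M_def by (auto elim!: evenE oddE)
  moreover have "prod g ((B \<union> C) \<union> M) = prod g (B \<union> C) * prod g M"
    by (rule prod.union_disjoint) (auto simp: B_def C_def M_def)
  moreover have "prod g (B \<union> C) = prod g B * prod g C"
    by (rule prod.union_disjoint) (auto simp: B_def C_def)
  moreover have "prod g C = prod (\<lambda>i. g (t - i)) B"
    by (rule prod.reindex_bij_witness[of _ "\<lambda>i. t - i" "\<lambda>i. t - i"]) (auto simp: B_def C_def)
  moreover have "prod g M = (if even t then g (t div 2) else 1)"
    by (simp add: M_def)
  ultimately show ?thesis
    by (simp add: prod.distrib B_def)
qed

context odd_finite_field
begin

text \<open>The case \<open>t = 1\<close> of \<open>norm_S_1\<close> supplies the modulus that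
  \<open>gauss_sum_sign\<close> asks for.\<close>

lemma gauss_sum_F1_value:
  "(\<Sum>x\<in>F 1. e (x\<^sup>2)) = (if p mod 4 = 1 then 1 else \<i>) * sqrt p"
proof -
  interpret K: odd_finite_subfield p n field_type 1
    by unfold_locales auto
  have "K.S 1 = (\<Sum>x\<in>F 1. e (x\<^sup>2))"
    by (simp add: K.S_def psi_eq ff_trace_def)
  hence "norm (\<Sum>j<p. cis (2 * pi / p) ^ (j\<^sup>2)) = sqrt p"
    using K.norm_S_1 by (simp add: gauss_sum_F1)
  thus ?thesis
    unfolding gauss_sum_F1 using odd_p p_gt_1 by (intro gauss_sum_sign) auto
qed

lemma p_power_mod_4: "p ^ k mod 4 = (if p mod 4 = 1 \<or> even k then 1 else 3)"
proof -
  have "p mod 4 = 1 \<or> p mod 4 = 3"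
    using odd_p by presburger
  moreover have "(3::nat) ^ k mod 4 = (if even k then 1 else 3)"
  proof (induction k)
    case (Suc k)
    have "(3::nat) ^ Suc k mod 4 = 3 * (3 ^ k mod 4) mod 4"
      by (simp add: mod_mult_right_eq)
    thus ?case
      unfolding Suc by simp
  qed simp
  ultimately show ?thesis
    by (subst power_mod[symmetric]) auto
qed

end

context odd_finite_subfield
begin

lemma chi_minus_1_eq: "chi (-1) = (if p mod 4 = 1 \<or> even t then 1 else -1)"
proof -
  have "p ^ t > 0"
    by simp
  hence "p ^ t = 2 * h + 1"
    using two_h by linarith
  moreover have "even h \<longleftrightarrow> (2 * h + 1) mod 4 = 1"
    by presburger
  ultimately have "even h \<longleftrightarrow> p mod 4 = 1 \<or> even t"
    using p_power_mod_4[of t] by simp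
  thus ?thesis
    by (auto simp: chi_minus_1)
qed

text \<open>An element with a coincidence is fixed by the Frobenius power of some exponent
  \<open>i\<close> in \<open>{1..<t}\<close>. There are at most \<open>p ^ i\<close> such elements
  for each \<open>i\<close>, and the sum of these bounds is below \<open>p ^ t\<close>.\<close>

lemma ex_distinct_conjugates: "\<exists>\<theta>\<in>F t. \<forall>i\<in>{1..<t}. \<theta> ^ (p ^ i) \<noteq> \<theta>"
proof (rule ccontr)
  assume "\<not> ?thesis"
  hence "F t \<subseteq> (\<Union>i\<in>{1..<t}. {x. x ^ (p ^ i) = 1 * x + 0})"
    by auto
  hence "card (F t) \<le> card (\<Union>i\<in>{1..<t}. {x::'a. x ^ (p ^ i) = 1 * x + 0})"
    by (intro card_mono) auto
  also have "\<dots> \<le> (\<Sum>i\<in>{1..<t}. card {x::'a. x ^ (p ^ i) = 1 * x + 0})"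
    by (intro card_UN_le) auto
  also have "\<dots> \<le> (\<Sum>i\<in>{1..<t}. p ^ i)"
  proof (intro sum_mono card_power_eq_linear_le)
    fix i assume "i \<in> {1..<t}"
    hence "p ^ i > 1"
      using p_gt_1 by (intro one_less_power) auto
    thus "p ^ i = 1 \<Longrightarrow> (1::'a) = 0"
      by simp
  qed simp
  also have "\<dots> \<le> (\<Sum>i<t. p ^ i)"
    by (intro sum_mono2) auto
  also have "\<dots> < p ^ t"
  proof (induction t)
    case (Suc k)
    hence "(\<Sum>i<Suc k. p ^ i) < 2 * p ^ k"
      by simp
    also have "\<dots> \<le> p * p ^ k"
      using p_gt_1 by (intro mult_right_mono) auto
    finally show ?case by simp
  qed simp
  finally show False
    by (simp add: card_Ft)
qed

end

section \<open>A generator, its conjugates and the trace form scaled by the inverse of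
  \<open>D\<close>\<close>

locale finite_subfield_generator = odd_finite_subfield p n field_type t
  for p n and field_type :: "'a::{field,finite} itself" and t +
  fixes \<theta> :: 'a
  assumes theta [simp]: "\<theta> \<in> F t" and conj_neq: "\<And>i. i \<in> {1..<t} \<Longrightarrow> \<theta> ^ (p ^ i) \<noteq> \<theta>"
begin

definition conjs :: "'a set" where
  "conjs = (\<lambda>i. \<theta> ^ (p ^ i)) ` {..<t}"

text \<open>The derivative at \<open>\<theta>\<close> of the product of the linear polynomials
  \<open>X - b\<close> over the conjugates \<open>b\<close> of \<open>\<theta>\<close>.\<close>

definition D :: 'a where
  "D = (\<Prod>i\<in>{1..<t}. \<theta> - \<theta> ^ (p ^ i))"

lemma inj_conjs: "inj_on (\<lambda>i. \<theta> ^ (p ^ i)) {..<t}"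
proof (rule linorder_inj_onI)
  fix i j assume ij: "i < j" "j \<in> {..<t}"
  show "\<theta> ^ (p ^ i) \<noteq> \<theta> ^ (p ^ j)"
  proof
    assume "\<theta> ^ (p ^ i) = \<theta> ^ (p ^ j)"
    also have "\<dots> = (\<theta> ^ (p ^ (j - i))) ^ (p ^ i)"
      using ij by (simp flip: power_mult power_add)
    finally have "\<theta> = \<theta> ^ (p ^ (j - i))"
      using injD[OF inj_frob] by blast
    moreover have "1 \<le> j - i" "j - i < t"
      using ij by (simp_all add: One_nat_def)
    ultimately show False
      using conj_neq[of "j - i"] by simp
  qed
qed auto

lemma card_conjs: "card conjs = t"
  unfolding conjs_def by (subst card_image[OF inj_conjs]) simp

lemma finite_conjs [simp]: "finite conjs"
  by (simp add: conjs_def)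

lemma frob_conjs: "(\<lambda>x. x ^ (p ^ i)) ` conjs = conjs"
proof (rule endo_inj_surj)
  show "(\<lambda>x. x ^ (p ^ i)) ` conjs \<subseteq> conjs"
  proof
    fix y assume "y \<in> (\<lambda>x. x ^ (p ^ i)) ` conjs"
    then obtain j where "y = \<theta> ^ (p ^ (j + i))"
      by (auto simp: conjs_def simp flip: power_mult power_add)
    hence "y = \<theta> ^ (p ^ ((j + i) mod t))"
      by (simp add: frob_mod)
    thus "y \<in> conjs"
      by (auto simp: conjs_def)
  qed
qed (auto intro: inj_on_subset[OF inj_frob])

lemma D_eq: "D = (\<Prod>b\<in>conjs - {\<theta>}. \<theta> - b)"
proof -
  have "conjs = (\<lambda>i. \<theta> ^ (p ^ i)) ` insert 0 {1..<t}"
    unfolding conjs_def using t_pos by (intro arg_cong[where f = "\<lambda>X. _ ` X"]) auto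
  hence "conjs - {\<theta>} = (\<lambda>i. \<theta> ^ (p ^ i)) ` {1..<t}"
    using conj_neq by auto
  moreover have "inj_on (\<lambda>i. \<theta> ^ (p ^ i)) {1..<t}"
    by (rule inj_on_subset[OF inj_conjs]) auto
  ultimately show ?thesis
    by (simp add: D_def prod.reindex)
qed

text \<open>Frobenius powers permute \<open>conjs\<close>, so conjugating \<open>D\<close> gives the
  same product based at another conjugate. These are the denominators in Euler's formula, and so the
  trace of \<open>lam * \<theta> ^ k\<close> becomes the Lagrange sum over
  \<open>conjs\<close>.\<close>

lemma D_conj: "D ^ (p ^ i) = (\<Prod>b\<in>conjs - {\<theta> ^ (p ^ i)}. \<theta> ^ (p ^ i) - b)"
proof -
  let ?f = "\<lambda>x::'a. x ^ (p ^ i)"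
  have "D ^ (p ^ i) = (\<Prod>b\<in>conjs - {\<theta>}. ?f \<theta> - ?f b)"
    unfolding D_eq prod_power_distrib frob_diff ..
  also have "\<dots> = (\<Prod>b\<in>?f ` (conjs - {\<theta>}). ?f \<theta> - b)"
    by (subst prod.reindex) (auto intro: inj_on_subset[OF inj_frob])
  also have "?f ` (conjs - {\<theta>}) = conjs - {?f \<theta>}"
    using image_set_diff[OF inj_frob, of i conjs "{\<theta>}"] frob_conjs[of i] by simp
  finally show ?thesis .
qed

lemma D_in_F [simp]: "D \<in> F t"
  unfolding D_def by (intro F_prod F_diff F_power theta)

lemma D_nonzero [simp]: "D \<noteq> 0"
  using conj_neq by (auto simp: D_def eq_commute[of \<theta>])

definition lam :: 'a where
  "lam = inverse D"

lemma lam_in_F [simp]: "lam \<in> F t" and lam_nonzero [simp]: "lam \<noteq> 0"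
  by (auto simp: lam_def)

lemma trace_lam_power:
  assumes "k < t"
  shows "Tr t (lam * \<theta> ^ k) = (if k = t - 1 then 1 else 0)"
proof -
  have "Tr t (lam * \<theta> ^ k) = (\<Sum>i<t. (\<theta> ^ (p ^ i)) ^ k / (\<Prod>b\<in>conjs - {\<theta> ^ (p ^ i)}. \<theta> ^ (p ^ i) - b))"
    unfolding ff_trace_def D_conj[symmetric]
    by (simp add: lam_def power_mult_distrib power_inverse divide_inverse mult.commute flip: power_mult)
  also have "\<dots> = (\<Sum>a\<in>conjs. a ^ k / (\<Prod>b\<in>conjs - {a}. a - b))"
    unfolding conjs_def by (subst sum.reindex[OF inj_conjs]) simp
  also have "\<dots> = (if k = t - 1 then 1 else 0)"
    using assms by (subst lagrange_power_sum) (simp_all add: card_conjs)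
  finally show ?thesis .
qed

definition lin :: "nat \<Rightarrow> (nat \<Rightarrow> 'a) \<Rightarrow> 'a" where
  "lin k c = (\<Sum>i<k. c i * \<theta> ^ i)"

text \<open>The span of the first \<open>k\<close> powers of \<open>\<theta>\<close> over the prime
  field. Coefficient families are extensional, so that \<open>lin k\<close> can be injective on them
  and they can be counted.\<close>

definition W :: "nat \<Rightarrow> 'a set" where
  "W k = lin k ` ({..<k} \<rightarrow>\<^sub>E F 1)"

lemma F1_subset: "x \<in> F 1 \<Longrightarrow> x \<in> F t"
  by (rule F_mono[of 1]) auto

lemma lin_in_F: "(\<And>i. i < k \<Longrightarrow> c i \<in> F 1) \<Longrightarrow> lin k c \<in> F t"
  unfolding lin_def by (intro F_sum F_mult F_power F1_subset theta) auto

lemma lin_in_W: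
  assumes "\<And>i. i < k \<Longrightarrow> c i \<in> F 1"
  shows "lin k c \<in> W k"
proof -
  have "lin k c = lin k (restrict c {..<k})"
    by (simp add: lin_def)
  thus ?thesis
    using assms unfolding W_def by auto
qed

lemma W_cases:
  assumes "x \<in> W k"
  obtains c where "\<And>i. i < k \<Longrightarrow> c i \<in> F 1" "x = lin k c"
  using assms by (auto simp: W_def)

lemma W_add: "x \<in> W k \<Longrightarrow> y \<in> W k \<Longrightarrow> x + y \<in> W k"
  and W_diff: "x \<in> W k \<Longrightarrow> y \<in> W k \<Longrightarrow> x - y \<in> W k"
proof -
  assume "x \<in> W k" "y \<in> W k"
  then obtain c d where c: "\<And>i. i < k \<Longrightarrow> c i \<in> F 1" "\<And>i. i < k \<Longrightarrow> d i \<in> F 1"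
    and xy: "x = lin k c" "y = lin k d"
    by (metis W_cases)
  have "x + y = lin k (\<lambda>i. c i + d i)" "x - y = lin k (\<lambda>i. c i - d i)"
    by (simp_all add: xy lin_def sum.distrib sum_subtractf algebra_simps)
  thus "x + y \<in> W k" "x - y \<in> W k"
    using c by (auto intro!: lin_in_W)
qed

lemma W_in_F: "x \<in> W k \<Longrightarrow> x \<in> F t"
  by (elim W_cases) (simp add: lin_in_F)

lemma trace_lam_lin:
  assumes "\<And>i. i < k \<Longrightarrow> c i \<in> F 1"
  shows "Tr t (lam * z * lin k c) = (\<Sum>i<k. c i * Tr t (lam * (z * \<theta> ^ i)))"
proof -
  have "lam * z * lin k c = (\<Sum>i<k. c i * (lam * (z * \<theta> ^ i)))"
    by (simp add: lin_def sum_distrib_left mult_ac)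
  thus ?thesis
    using assms by (simp add: trace_sum trace_scale)
qed

text \<open>The matrix of the traces of \<open>lam * \<theta> ^ (i + j)\<close> is 0 for
  \<open>i + j < t - 1\<close> and 1 for \<open>i + j = t - 1\<close>. It is triangular with respect
  to the antidiagonal, so orthogonality to the first \<open>r\<close> powers kills the coefficients
  one by one from the top.\<close>

lemma coeffs_vanish:
  assumes c: "\<And>i. i < t \<Longrightarrow> c i \<in> F 1" and "r \<le> t"
    and orth: "\<And>j. j < r \<Longrightarrow> Tr t (lam * \<theta> ^ j * lin t c) = 0"
    and "j < r"
  shows "c (t - 1 - j) = 0"
  using \<open>j < r\<close>
proof (induction j rule: less_induct)
  case (less j)
  have "c i * Tr t (lam * (\<theta> ^ j * \<theta> ^ i)) = (if i = t - 1 - j then c i else 0)" if "i < t" for i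
  proof (cases "i + j < t")
    case True
    thus ?thesis
      using trace_lam_power[of "j + i"] by (auto simp: power_add)
  next
    case False
    \<comment> \<open>Beyond the antidiagonal the trace is unknown, but the coefficient is already
      zero: \<open>i\<close> equals \<open>t - 1 - (t - 1 - i)\<close>, and
      \<open>t - 1 - i < j\<close> allows the induction hypothesis.\<close>
    hence "c (t - 1 - (t - 1 - i)) = 0"
      using that less \<open>r \<le> t\<close> by (intro less) auto
    hence "c i = 0"
      using that by simp
    thus ?thesis by auto
  qed
  hence "(\<Sum>i<t. c i * Tr t (lam * (\<theta> ^ j * \<theta> ^ i))) = (\<Sum>i<t. if i = t - 1 - j then c i else 0)"
    by (intro sum.cong) auto
  also have "\<dots> = c (t - 1 - j)"
    by (subst sum.delta) auto
  finally show ?case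
    using orth[OF less.prems] c by (simp add: trace_lam_lin)
qed

lemma lin_extend:
  assumes "k \<le> t"
  shows "lin t (\<lambda>i. if i < k then c i else 0) = lin k c"
  unfolding lin_def using assms by (intro sum.mono_neutral_cong_right) auto

text \<open>The first \<open>t\<close> powers of \<open>\<theta>\<close> are independent over the
  prime field: zero is orthogonal to everything, so \<open>coeffs_vanish\<close> applies with
  \<open>r = t\<close> after padding by zeros.\<close>

lemma lin_eq_0:
  assumes c: "\<And>i. i < k \<Longrightarrow> c i \<in> F 1" and "k \<le> t" and "lin k c = 0" and "i < k"
  shows "c i = 0"
proof -
  let ?c = "\<lambda>i. if i < k then c i else 0"
  have "?c (t - 1 - (t - 1 - i)) = 0"
    by (rule coeffs_vanish[of ?c t]) (use assms in \<open>auto simp: lin_extend\<close>)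
  thus ?thesis
    using assms by (simp split: if_splits)
qed

lemma inj_lin:
  assumes "k \<le> t"
  shows "inj_on (lin k) ({..<k} \<rightarrow>\<^sub>E F 1)"
proof (rule inj_onI)
  fix c d assume cd: "c \<in> {..<k} \<rightarrow>\<^sub>E F 1" "d \<in> {..<k} \<rightarrow>\<^sub>E F 1" "lin k c = lin k d"
  have "lin k (\<lambda>i. c i - d i) = 0"
    using cd(3) by (simp add: lin_def sum_subtractf algebra_simps)
  hence "c i - d i = 0" if "i < k" for i
    using assms that cd by (intro lin_eq_0[of k "\<lambda>i. c i - d i"]) auto
  thus "c = d"
    using cd by (intro PiE_ext) auto
qed

lemma W_t: "W t = F t"
proof (rule card_subset_eq)
  have "card (W t) = card ({..<t} \<rightarrow>\<^sub>E F 1)"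
    unfolding W_def by (rule card_image) (simp add: inj_lin)
  also have "\<dots> = p ^ t"
    using card_F[of 1] by (simp add: card_PiE)
  finally show "card (W t) = card (F t)"
    by (simp add: card_Ft)
qed (auto simp: W_in_F)

text \<open>\<open>W (t - r)\<close> is the orthogonal complement of \<open>W r\<close>. One
  direction is \<open>coeffs_vanish\<close>; in the other all exponents are at most
  \<open>t - 2\<close>, where the traces vanish.\<close>

lemma orthogonal_iff:
  assumes x: "x \<in> F t" and r: "r \<le> t"
  shows "(\<forall>j<r. Tr t (lam * \<theta> ^ j * x) = 0) \<longleftrightarrow> x \<in> W (t - r)"
proof
  assume orth: "\<forall>j<r. Tr t (lam * \<theta> ^ j * x) = 0"
  obtain c where c: "\<And>i. i < t \<Longrightarrow> c i \<in> F 1" "x = lin t c"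
    using x W_t by (metis W_cases)
  have "c i = 0" if "t - r \<le> i" "i < t" for i
    using coeffs_vanish[of c r "t - 1 - i"] c orth r that by auto
  hence "x = lin (t - r) c"
    unfolding c(2) lin_def by (intro sum.mono_neutral_right) auto
  thus "x \<in> W (t - r)"
    using c by (simp add: lin_in_W)
next
  assume "x \<in> W (t - r)"
  then obtain c where c: "\<And>i. i < t - r \<Longrightarrow> c i \<in> F 1" "x = lin (t - r) c"
    by (metis W_cases)
  show "\<forall>j<r. Tr t (lam * \<theta> ^ j * x) = 0"
  proof (intro allI impI)
    fix j assume "j < r"
    have "Tr t (lam * \<theta> ^ j * x) = (\<Sum>i<t - r. c i * Tr t (lam * (\<theta> ^ j * \<theta> ^ i)))"
      unfolding c(2) using c(1) by (rule trace_lam_lin)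
    also have "\<dots> = 0"
      using \<open>j < r\<close> by (intro sum.neutral) (auto simp: trace_lam_power simp flip: power_add)
    finally show "Tr t (lam * \<theta> ^ j * x) = 0" .
  qed
qed

text \<open>The exponents \<open>i + j\<close> are at most \<open>2 * k - 2 \<le> t - 1\<close>, so
  only the product of the two top terms can have nonzero trace, and only for
  \<open>2 * k = t + 1\<close>. For \<open>k = t div 2\<close> this is isotropy; for
  \<open>k = t - t div 2\<close> it gives the form that remains on the complement.\<close>

lemma trace_lam_lin_square:
  assumes c: "\<And>i. i < k \<Longrightarrow> c i \<in> F 1" and k: "2 * k \<le> t + 1"
  shows "Tr t (lam * (lin k c)\<^sup>2) = (if 2 * k = t + 1 then (c (k - 1))\<^sup>2 else 0)"
proof -
  have "Tr t (lam * (lin k c)\<^sup>2) = Tr t (lam * lin k c * lin k c)"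
    by (simp add: power2_eq_square mult_ac)
  also have "\<dots> = (\<Sum>i<k. c i * Tr t (lam * \<theta> ^ i * lin k c))"
    using c by (subst trace_lam_lin) (simp_all add: mult_ac)
  also have "\<dots> = (\<Sum>i<k. c i * (\<Sum>j<k. c j * Tr t (lam * (\<theta> ^ i * \<theta> ^ j))))"
    using c by (intro sum.cong refl) (simp add: trace_lam_lin)
  also have "\<dots> = (\<Sum>i<k. \<Sum>j<k. c i * c j * Tr t (lam * (\<theta> ^ i * \<theta> ^ j)))"
    by (simp add: sum_distrib_left mult_ac)
  also have "\<dots> = (\<Sum>i<k. \<Sum>j<k. if j = k - 1 then if i = k - 1 \<and> 2 * k = t + 1 then (c (k - 1))\<^sup>2 else 0 else 0)"
  proof (rule sum.cong[OF refl], rule sum.cong[OF refl])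
    fix i j assume ij: "i \<in> {..<k}" "j \<in> {..<k}"
    have iff: "i + j = t - 1 \<longleftrightarrow> j = k - 1 \<and> i = k - 1 \<and> 2 * k = t + 1"
      using ij k by auto
    show "c i * c j * Tr t (lam * (\<theta> ^ i * \<theta> ^ j))
        = (if j = k - 1 then if i = k - 1 \<and> 2 * k = t + 1 then (c (k - 1))\<^sup>2 else 0 else 0)"
      using ij k trace_lam_power[of "i + j"] unfolding power_add iff by (auto simp: power2_eq_square)
  qed
  also have "\<dots> = (\<Sum>i<k. if i = k - 1 then if 2 * k = t + 1 then (c (k - 1))\<^sup>2 else 0 else 0)"
    by (intro sum.cong refl) (subst sum.delta, auto)
  also have "\<dots> = (if 2 * k = t + 1 then (c (k - 1))\<^sup>2 else 0)"
    by (subst sum.delta) auto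
  finally show ?thesis .
qed

text \<open>Translation by an isotropic \<open>w\<close> in \<open>W r\<close> changes the summand
  only by a character linear in \<open>w\<close>. Summing over all these \<open>w\<close> and using
  orthogonality restricts \<open>x\<close> to the complement \<open>W (t - r)\<close>.\<close>

lemma S_lam_eq_sum_W:
  defines "r \<equiv> t div 2"
  shows "S lam = (\<Sum>x\<in>W (t - r). psi t (lam * x\<^sup>2))"
proof -
  have r: "r \<le> t" "2 * r \<le> t"
    by (simp_all add: r_def)
  have shift: "S lam = (\<Sum>x\<in>F t. psi t (lam * x\<^sup>2) * psi t (2 * lam * x * w))" if w: "w \<in> W r" for w
  proof -
    obtain c where c: "\<And>i. i < r \<Longrightarrow> c i \<in> F 1" "w = lin r c"
      using w by (metis W_cases)
    have wF: "w \<in> F t"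
      using w by (rule W_in_F)
    have "Tr t (lam * w\<^sup>2) = 0"
      unfolding c(2) using c(1) r by (subst trace_lam_lin_square) auto
    hence w2: "psi t (lam * w\<^sup>2) = 1"
      using wF by (subst psi_eq_1_iff) auto
    have "S lam = (\<Sum>x\<in>F t. psi t (lam * (x + w)\<^sup>2))"
      unfolding S_def
      by (rule sum.reindex_bij_witness[of _ "\<lambda>x. x + w" "\<lambda>x. x - w"]) (use wF in auto)
    also have "\<dots> = (\<Sum>x\<in>F t. psi t (lam * x\<^sup>2) * psi t (2 * lam * x * w))"
    proof (rule sum.cong[OF refl])
      fix x assume x: "x \<in> F t"
      have "lam * (x + w)\<^sup>2 = (lam * x\<^sup>2 + 2 * lam * x * w) + lam * w\<^sup>2"
        by (simp add: power2_sum algebra_simps)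
      moreover have "psi t ((lam * x\<^sup>2 + 2 * lam * x * w) + lam * w\<^sup>2)
          = psi t (lam * x\<^sup>2 + 2 * lam * x * w) * psi t (lam * w\<^sup>2)"
        using x wF by (intro psi_add F_add F_mult F_power lam_in_F F_2)
      moreover have "psi t (lam * x\<^sup>2 + 2 * lam * x * w) = psi t (lam * x\<^sup>2) * psi t (2 * lam * x * w)"
        using x wF by (intro psi_add F_mult F_power lam_in_F F_2)
      ultimately show "psi t (lam * (x + w)\<^sup>2) = psi t (lam * x\<^sup>2) * psi t (2 * lam * x * w)"
        using w2 by simp
    qed
    finally show ?thesis .
  qed
  have inner: "(\<Sum>w\<in>W r. psi t (2 * lam * x * w)) = (if x \<in> W (t - r) then of_nat (card (W r)) else 0)"
    if x: "x \<in> F t" for x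
  proof -
    have "(\<forall>w\<in>W r. psi t (2 * lam * x * w) = 1) \<longleftrightarrow> (\<forall>w\<in>W r. Tr t (lam * x * w) = 0)"
    proof (intro ball_cong refl)
      fix w assume "w \<in> W r"
      hence "w \<in> F t"
        by (rule W_in_F)
      hence "2 * lam * x * w \<in> F t"
        using x by (intro F_mult lam_in_F F_2)
      moreover have "Tr t (2 * (lam * x * w)) = 2 * Tr t (lam * x * w)"
        by (rule trace_scale) simp
      ultimately show "psi t (2 * lam * x * w) = 1 \<longleftrightarrow> Tr t (lam * x * w) = 0"
        by (simp add: psi_eq_1_iff mult.assoc)
    qed
    also have "\<dots> \<longleftrightarrow> (\<forall>j<r. Tr t (lam * \<theta> ^ j * x) = 0)"
    proof (intro iffI ballI allI impI)
      fix j assume *: "\<forall>w\<in>W r. Tr t (lam * x * w) = 0" and j: "j < r"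
      have "lin r (\<lambda>i. if i = j then 1 else 0) = (\<Sum>i<r. if i = j then \<theta> ^ j else 0)"
        unfolding lin_def by (intro sum.cong refl) auto
      also have "\<dots> = \<theta> ^ j"
        using j by (subst sum.delta) auto
      finally have "\<theta> ^ j \<in> W r"
        using lin_in_W[of r "\<lambda>i. if i = j then 1 else 0"] by simp
      hence "Tr t (lam * x * \<theta> ^ j) = 0"
        using * by blast
      thus "Tr t (lam * \<theta> ^ j * x) = 0"
        by (simp add: mult_ac)
    next
      fix w assume *: "\<forall>j<r. Tr t (lam * \<theta> ^ j * x) = 0" and "w \<in> W r"
      then obtain c where c: "\<And>i. i < r \<Longrightarrow> c i \<in> F 1" "w = lin r c"
        by (metis W_cases)
      have "Tr t (lam * x * w) = (\<Sum>i<r. c i * Tr t (lam * (x * \<theta> ^ i)))"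
        unfolding c(2) using c(1) by (rule trace_lam_lin)
      also have "\<dots> = 0"
        using * by (intro sum.neutral) (auto simp: mult_ac)
      finally show "Tr t (lam * x * w) = 0" .
    qed
    also have "\<dots> \<longleftrightarrow> x \<in> W (t - r)"
      using x r(1) by (rule orthogonal_iff)
    finally have iff: "(\<forall>w\<in>W r. psi t (2 * lam * x * w) = 1) \<longleftrightarrow> x \<in> W (t - r)" .
    have "(\<Sum>w\<in>W r. psi t (2 * lam * x * w))
        = (if \<forall>w\<in>W r. psi t (2 * lam * x * w) = 1 then of_nat (card (W r)) else 0)"
    proof (rule subgroup_character_sum)
      fix v w assume "v \<in> W r" "w \<in> W r"
      hence "v \<in> F t" "w \<in> F t"
        by (auto intro: W_in_F)
      thus "psi t (2 * lam * x * (v + w)) = psi t (2 * lam * x * v) * psi t (2 * lam * x * w)"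
        unfolding distrib_left using x by (intro psi_add F_mult lam_in_F F_2)
    qed (auto intro: W_add W_diff)
    thus ?thesis
      unfolding iff .
  qed
  have "of_nat (card (W r)) * S lam = (\<Sum>w\<in>W r. \<Sum>x\<in>F t. psi t (lam * x\<^sup>2) * psi t (2 * lam * x * w))"
    by (simp flip: shift)
  also have "\<dots> = (\<Sum>x\<in>F t. psi t (lam * x\<^sup>2) * (\<Sum>w\<in>W r. psi t (2 * lam * x * w)))"
    by (subst sum.swap) (simp add: sum_distrib_left)
  also have "\<dots> = (\<Sum>x\<in>F t. if x \<in> W (t - r) then of_nat (card (W r)) * psi t (lam * x\<^sup>2) else 0)"
    by (intro sum.cong refl) (simp add: inner)
  also have "\<dots> = (\<Sum>x\<in>F t \<inter> W (t - r). of_nat (card (W r)) * psi t (lam * x\<^sup>2))"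
    by (simp add: sum.inter_restrict)
  also have "F t \<inter> W (t - r) = W (t - r)"
    using W_in_F by auto
  also have "(\<Sum>x\<in>W (t - r). of_nat (card (W r)) * psi t (lam * x\<^sup>2))
      = of_nat (card (W r)) * (\<Sum>x\<in>W (t - r). psi t (lam * x\<^sup>2))"
    by (simp add: sum_distrib_left)
  finally have "of_nat (card (W r)) * S lam = of_nat (card (W r)) * (\<Sum>x\<in>W (t - r). psi t (lam * x\<^sup>2))" .
  moreover have "W r \<noteq> {}"
    using lin_in_W[of r "\<lambda>_. 0"] by auto
  ultimately show ?thesis
    by simp
qed

text \<open>For even \<open>t\<close> the form vanishes on \<open>W (t - r)\<close>, which is
  \<open>W r\<close> itself. For odd \<open>t\<close> there is one further coefficient,
  \<open>c r\<close>, and the form is its square: the other \<open>r\<close> coefficients are free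
  and contribute a factor \<open>p\<close> each.\<close>

lemma S_lam:
  "S lam = of_nat p ^ (t div 2) * (if even t then 1 else (\<Sum>x\<in>F 1. e (x\<^sup>2)))"
proof -
  define r where "r = t div 2"
  define k where "k = t - r"
  have cardF1: "card (F 1) = p"
    using card_F[of 1] by simp
  have "S lam = (\<Sum>c\<in>{..<k} \<rightarrow>\<^sub>E F 1. psi t (lam * (lin k c)\<^sup>2))"
    unfolding S_lam_eq_sum_W r_def[symmetric] k_def[symmetric] W_def
    by (subst sum.reindex[OF inj_lin]) (simp_all add: k_def)
  also have "\<dots> = (\<Sum>c\<in>{..<k} \<rightarrow>\<^sub>E F 1. if even t then 1 else e ((c r)\<^sup>2))"
  proof (rule sum.cong[OF refl])
    fix c assume c: "c \<in> {..<k} \<rightarrow>\<^sub>E F 1"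
    have "2 * k \<le> t + 1" "2 * k = t + 1 \<longleftrightarrow> odd t" "odd t \<Longrightarrow> k - 1 = r"
      unfolding k_def r_def by presburger+
    thus "psi t (lam * (lin k c)\<^sup>2) = (if even t then 1 else e ((c r)\<^sup>2))"
      unfolding psi_eq using c by (subst trace_lam_lin_square) auto
  qed
  also have "\<dots> = of_nat p ^ r * (if even t then 1 else (\<Sum>x\<in>F 1. e (x\<^sup>2)))"
  proof (cases "even t")
    case True
    hence "k = r"
      unfolding k_def r_def by presburger
    thus ?thesis
      using True cardF1 by (simp add: card_PiE)
  next
    case False
    hence k: "k = Suc r"
      unfolding k_def r_def by presburger
    \<comment> \<open>Trivial factors at all indices but \<open>r\<close> give the summand product
      form, so that the sum over families factors.\<close>
    define f where "f i x = (if i = r then e (x\<^sup>2) else 1)" for i :: nat and x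
    have "(\<Sum>c\<in>{..<k} \<rightarrow>\<^sub>E F 1. e ((c r)\<^sup>2)) = (\<Sum>c\<in>{..<k} \<rightarrow>\<^sub>E F 1. \<Prod>i<k. f i (c i))"
      by (intro sum.cong refl) (simp add: k f_def)
    also have "\<dots> = (\<Prod>i<k. \<Sum>x\<in>F 1. f i x)"
      by (rule prod_sum_PiE[symmetric]) auto
    also have "\<dots> = of_nat p ^ r * (\<Sum>x\<in>F 1. e (x\<^sup>2))"
      by (simp add: k f_def cardF1)
    finally show ?thesis
      using False by simp
  qed
  finally show ?thesis
    unfolding r_def .
qed

text \<open>The power \<open>p ^ (t - i)\<close> sends the factor of index \<open>i\<close> to minus
  the factor of index \<open>t - i\<close>, and this odd power does not change \<open>chi\<close>.
  So each pair contributes \<open>chi (-1)\<close>; for even \<open>t\<close> the middle factor is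
  treated separately.\<close>

lemma chi_D: "chi D = (if even t then (-1) ^ ((p ^ (t div 2) + 1) div 2) else chi (-1) ^ (t div 2))"
proof -
  define b where "b i = \<theta> - \<theta> ^ (p ^ i)" for i
  have b: "b i \<in> F t" "b i \<noteq> 0" if "i \<in> {1..<t}" for i
    unfolding b_def using conj_neq[OF that] by (auto simp: F_diff F_power)
  have b_conj: "b i ^ (p ^ (t - i)) = - b (t - i)" if "i \<in> {1..<t}" for i
  proof -
    have "(\<theta> ^ (p ^ i)) ^ (p ^ (t - i)) = \<theta> ^ (p ^ t)"
      using that by (simp flip: power_mult power_add)
    also have "\<dots> = \<theta>"
      using theta unfolding in_F_iff .
    finally show ?thesis
      by (simp add: b_def frob_diff)
  qed
  have pair: "chi (b i) * chi (b (t - i)) = chi (-1)" if i: "i \<in> {1..<t}" for i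
  proof -
    have ti: "t - i \<in> {1..<t}"
      using i by auto
    have "chi (b i) ^ (p ^ (t - i)) = chi (- 1 * b (t - i))"
      using b_conj[OF i] chi_power[OF b(1)[OF i], of "p ^ (t - i)"] by simp
    also have "\<dots> = chi (-1) * chi (b (t - i))"
      using b(1)[OF ti] by (intro chi_mult) auto
    also have "chi (b i) ^ (p ^ (t - i)) = chi (b i)"
      using chi_cases[OF b(2)[OF i]] odd_p by auto
    finally show ?thesis
      using chi_square[OF b(2)[OF ti]] by (simp add: mult.assoc)
  qed
  have "chi D = (\<Prod>i\<in>{1..<t}. chi (b i))"
    unfolding D_def b_def[symmetric] by (rule chi_prod) (rule b)
  also have "\<dots> = (\<Prod>i\<in>{1..<(t + 1) div 2}. chi (b i) * chi (b (t - i))) * (if even t then chi (b (t div 2)) else 1)"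
    by (rule prod_pair_up) simp
  also have "(\<Prod>i\<in>{1..<(t + 1) div 2}. chi (b i) * chi (b (t - i))) = (\<Prod>i\<in>{1..<(t + 1) div 2}. chi (-1))"
    by (intro prod.cong refl pair) auto
  also have "\<dots> = chi (-1) ^ ((t + 1) div 2 - 1)"
    by simp
  finally have *: "chi D = chi (-1) ^ ((t + 1) div 2 - 1) * (if even t then chi (b (t div 2)) else 1)" .
  show ?thesis
  proof (cases "even t")
    case False
    hence "(t + 1) div 2 - 1 = t div 2"
      by presburger
    thus ?thesis
      using * False by simp
  next
    case True
    then obtain r where r: "t = 2 * r" "r > 0"
      using t_pos by (auto elim: evenE)
    define q where "q = p ^ r"
    have q: "odd q" "q > 0"
      using odd_p by (simp_all add: q_def)
    have br: "b r \<in> F t" "b r \<noteq> 0"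
      using b[of r] r by auto
    \<comment> \<open>The middle index \<open>r\<close> is paired with itself, so the power
      \<open>q = p ^ r\<close> negates \<open>b r\<close>. With
      \<open>h = (q - 1) * ((q + 1) div 2)\<close> Euler's criterion gives its character.\<close>
    have "b r ^ q = - b r"
      using b_conj[of r] r by (simp add: q_def mult_2)
    moreover have "b r ^ q = b r * b r ^ (q - 1)"
      using q by (simp flip: power_Suc)
    ultimately have m1: "b r ^ (q - 1) = -1"
      using br by (metis mult_cancel_left mult_minus1_right)
    have "h = (q - 1) * ((q + 1) div 2)"
    proof -
      obtain l where l: "q = 2 * l + 1"
        using q by (elim oddE)
      have "p ^ t = q * q"
        by (simp add: q_def r mult_2 power_add)
      thus ?thesis
        unfolding h_def l by (simp add: algebra_simps)
    qed
    hence "b r ^ h = of_int ((-1) ^ ((q + 1) div 2))"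
      by (simp add: power_mult m1)
    hence "chi (b r) = (-1) ^ ((q + 1) div 2)"
      using br by (intro chi_eqI) (auto simp: minus_one_power_iff)
    moreover have "chi (-1) = 1"
      using True by (simp add: chi_minus_1_eq)
    ultimately show ?thesis
      using * True r by (simp add: q_def)
  qed
qed

lemma S_1_eq: "S 1 = of_int (chi D) * S lam"
proof -
  have "chi lam = chi D"
    unfolding lam_def by (rule chi_inverse) auto
  hence "S lam = of_int (chi D) * S 1"
    using S_eq_chi_times[of lam] by simp
  hence "of_int (chi D) * S lam = of_int (chi D * chi D) * S 1"
    by simp
  thus ?thesis
    by (simp add: chi_square)
qed

end

section \<open>The explicit value of the quadratic Gauss sum\<close>

context odd_finite_subfield
begin

lemma quadratic_gauss_sum:
  "S 1 = - ((-1) ^ t) * (if p mod 4 = 1 then 1 else \<i> ^ t) * of_real (real p powr (real t / 2))"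
proof -
  obtain \<theta> where "\<theta> \<in> F t" "\<forall>i\<in>{1..<t}. \<theta> ^ (p ^ i) \<noteq> \<theta>"
    using ex_distinct_conjugates by auto
  then interpret finite_subfield_generator p n field_type t \<theta>
    by unfold_locales auto
  define r where "r = t div 2"
  have pw: "real p ^ r = real p powr real r"
    by (simp add: powr_realpow)
  have p34: "p mod 4 = 1 \<or> p mod 4 = 3"
    using odd_p by presburger
  show ?thesis
  proof (cases "even t")
    case True
    hence t: "t = 2 * r"
      by (simp add: r_def)
    have "S lam = of_real (real p powr (real t / 2))"
      using True unfolding S_lam r_def[symmetric] by (simp add: t flip: pw)
    \<comment> \<open>For even \<open>t\<close> the whole sign comes from \<open>chi D\<close>,
      which is -1 exactly if \<open>p ^ r\<close> is 1 modulo 4.\<close>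
    moreover have "odd ((p ^ r + 1) div 2) \<longleftrightarrow> p ^ r mod 4 = 1"
      using odd_p even_power[of p r] by presburger
    hence "(-1) ^ ((p ^ r + 1) div 2) = (if p mod 4 = 1 \<or> even r then -1 else 1 :: int)"
      unfolding p_power_mod_4 by (auto simp: minus_one_power_iff)
    hence "chi D = (if p mod 4 = 1 \<or> even r then -1 else 1)"
      unfolding chi_D r_def[symmetric] using True by simp
    moreover have "\<i> ^ t = (-1) ^ r"
      by (simp add: t power_mult)
    ultimately show ?thesis
      unfolding S_1_eq using True by (auto simp: minus_one_power_iff)
  next
    case False
    hence t: "t = 2 * r + 1"
      unfolding r_def by presburger
    have "sqrt p = real p powr (1 / 2)"
      by (simp add: powr_half_sqrt)
    hence "real p ^ r * sqrt p = real p powr (real t / 2)"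
      unfolding pw by (simp add: t field_simps flip: powr_add)
    hence "complex_of_real (real p powr (real t / 2)) = of_nat p ^ r * of_real (sqrt p)"
      by (metis of_real_mult of_real_of_nat_eq of_real_power)
    hence "S lam = (if p mod 4 = 1 then 1 else \<i>) * of_real (real p powr (real t / 2))"
      unfolding S_lam r_def[symmetric] gauss_sum_F1_value using False by simp
    moreover have "chi D = (if p mod 4 = 1 then 1 else -1) ^ r"
      unfolding chi_D r_def[symmetric] chi_minus_1_eq using False by simp
    moreover have "\<i> ^ t = (-1) ^ r * \<i>"
      by (simp add: t power_add power_mult)
    ultimately show ?thesis
      unfolding S_1_eq using False by auto
  qed
qed

text \<open>As \<open>x\<^sup>2\<close> lies in \<open>F t\<close>, it can be pulled out of the
  inner trace, leaving \<open>S u\<close>. For \<open>u = 0\<close> the sum is \<open>p ^ t\<close>,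
  the square of the normalizing factor, which explains the first case of
  \<open>Gamma_fun\<close>.\<close>

lemma sum_char_square:
  "(\<Sum>x\<in>F t. add_char p n c (a * x\<^sup>2)) = of_real (real p powr (real t / 2)) * Gamma_fun p n t a c"
proof -
  define u where "u = ff_trace p n t (c * a)"
  define R where "R = complex_of_real (real p powr (real t / 2))"
  have u: "u \<in> F t"
    unfolding u_def using t_dvd n by (intro trace_in_F) auto
  have "add_char p n c (a * x\<^sup>2) = psi t (u * x\<^sup>2)" if "x \<in> F t" for x
  proof -
    have "add_char p n c (a * x\<^sup>2) = e (Tr t (ff_trace p n t (x\<^sup>2 * (c * a))))"
      unfolding add_char_eq trace_trans[OF t_dvd] by (simp add: mult_ac)
    also have "ff_trace p n t (x\<^sup>2 * (c * a)) = x\<^sup>2 * u"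
      unfolding u_def using that by (intro trace_scale F_power)
    finally show ?thesis
      by (simp add: psi_eq mult.commute)
  qed
  hence sum: "(\<Sum>x\<in>F t. add_char p n c (a * x\<^sup>2)) = S u"
    unfolding S_def by (intro sum.cong) auto
  show ?thesis
  proof (cases "u = 0")
    case True
    have "R * R = of_nat (p ^ t)"
      unfolding R_def of_real_mult[symmetric] powr_add[symmetric] by (simp add: powr_realpow)
    moreover have "S u = of_nat (p ^ t)"
      using True by (simp add: S_def card_Ft)
    ultimately show ?thesis
      unfolding sum using True by (simp add: Gamma_fun_def Let_def u_def R_def)
  next
    case False
    thus ?thesis
      unfolding sum S_eq_chi_times[OF u False] quadratic_gauss_sum
      by (simp add: Gamma_fun_def Let_def flip: u_def)
  qed
qed

end

section \<open>Counting solutions by orthogonality of characters\<close>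

context odd_finite_field
begin

lemma add_char_add: "add_char p n c (x + y :: 'a) = add_char p n c x * add_char p n c y"
proof -
  interpret odd_finite_subfield p n field_type n
    by unfold_locales (use n in auto)
  show ?thesis
    unfolding add_char_eq distrib_left unfolding psi_eq[symmetric] by (rule psi_add) auto
qed

lemma add_char_sum: "add_char p n c (\<Sum>i\<in>I. f i :: 'a) = (\<Prod>i\<in>I. add_char p n c (f i))"
  by (induction I rule: infinite_finite_induct) (simp_all add: add_char_add add_char_eq[of _ 0])

lemma sum_add_char: "(\<Sum>c\<in>UNIV. add_char p n c (y :: 'a)) = (if y = 0 then of_nat (p ^ n) else 0 :: complex)"
proof -
  interpret odd_finite_subfield p n field_type n
    by unfold_locales (use n in auto)
  have "F n = UNIV"
    by auto
  thus ?thesis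
    using psi_sum[of y] by (simp add: add_char_eq psi_eq mult.commute)
qed

text \<open>Summing \<open>add_char\<close> over \<open>c\<close> detects the equation with weight
  \<open>p ^ n\<close>. Exchanging the sums separates the variables, and each contributes one
  quadratic sum over its own subfield.\<close>

lemma card_solutions:
  fixes s :: nat
  assumes t: "\<forall>j<s. t j > 0 \<and> t j dvd n"
  shows "of_nat (p ^ n) * of_nat (card {x \<in> (\<Pi>\<^sub>E j\<in>{..<s}. F (t j)). (\<Sum>j<s. a j * (x j)\<^sup>2) = b})
    = (\<Sum>c\<in>UNIV. add_char p n c (- b) *
        (\<Prod>j<s. of_real (real p powr (real (t j) / 2)) * Gamma_fun p n (t j) (a j) c))"
proof -
  define X where "X = (\<Pi>\<^sub>E j\<in>{..<s}. F (t j))"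
  have "of_nat (p ^ n) * of_nat (card {x \<in> X. (\<Sum>j<s. a j * (x j)\<^sup>2) = b})
      = (\<Sum>x\<in>X. if (\<Sum>j<s. a j * (x j)\<^sup>2) = b then of_nat (p ^ n) else 0 :: complex)"
    by (subst sum.inter_filter[symmetric]) (auto simp: X_def intro!: finite_PiE)
  also have "\<dots> = (\<Sum>x\<in>X. \<Sum>c\<in>UNIV. add_char p n c ((\<Sum>j<s. a j * (x j)\<^sup>2) + - b))"
    unfolding sum_add_char by (intro sum.cong refl) auto
  also have "\<dots> = (\<Sum>c\<in>UNIV. \<Sum>x\<in>X. add_char p n c (- b) * (\<Prod>j<s. add_char p n c (a j * (x j)\<^sup>2)))"
    unfolding add_char_add add_char_sum mult.commute[of _ "add_char p n _ (- b)"] by (rule sum.swap)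
  \<comment> \<open>For fixed \<open>c\<close> the sum over tuples of a product of one-variable
    terms is the product of the sums over the subfields.\<close>
  also have "\<dots> = (\<Sum>c\<in>UNIV. add_char p n c (- b) * (\<Prod>j<s. \<Sum>x\<in>F (t j). add_char p n c (a j * x\<^sup>2)))"
    unfolding X_def sum_distrib_left[symmetric]
    by (intro sum.cong refl arg_cong[where f = "(*) _"] prod_sum_PiE[symmetric]) auto
  also have "\<dots> = (\<Sum>c\<in>UNIV. add_char p n c (- b) *
        (\<Prod>j<s. of_real (real p powr (real (t j) / 2)) * Gamma_fun p n (t j) (a j) c))"
  proof (rule sum.cong[OF refl], rule arg_cong[where f = "(*) _"], rule prod.cong[OF refl])
    fix c j assume "j \<in> {..<s}"
    then interpret odd_finite_subfield p n field_type "t j"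
      by unfold_locales (use t in auto)
    show "(\<Sum>x\<in>F (t j). add_char p n c (a j * x\<^sup>2))
        = of_real (real p powr (real (t j) / 2)) * Gamma_fun p n (t j) (a j) c"
      by (rule sum_char_square)
  qed
  finally show ?thesis
    unfolding X_def .
qed

end

theorem theorem5p3:
  fixes p n s :: nat and a :: "nat \<Rightarrow> 'a::{field,finite}" and b :: 'a and t :: "nat \<Rightarrow> nat"
  assumes "prime p" and "odd p" and "n > 0" and "CARD('a) = p ^ n"
    and "s \<ge> 1"
    and "\<forall>j < s. t j > 0 \<and> t j dvd n"
  shows "complex_of_nat (card {x \<in> (\<Pi>\<^sub>E j \<in> {..<s}. subfield_of_order (p ^ t j)).
                              (\<Sum>j<s. a j * (x j)\<^sup>2) = b})
       = of_real (real p powr (real (\<Sum>j<s. t j) / 2 - real n))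
         * (\<Sum>c\<in>UNIV. add_char p n c (- b) * (\<Prod>j<s. Gamma_fun p n (t j) (a j) c))"
proof -
  interpret odd_finite_field p n "TYPE('a)"
    by unfold_locales (use assms in auto)
  define N where "N = complex_of_nat (card {x \<in> (\<Pi>\<^sub>E j \<in> {..<s}. subfield_of_order (p ^ t j)).
                              (\<Sum>j<s. a j * (x j)\<^sup>2) = b})"
  define R where "R = (\<Prod>j<s. real p powr (real (t j) / 2))"
  define T where "T = (\<Sum>c\<in>UNIV. add_char p n c (- b) * (\<Prod>j<s. Gamma_fun p n (t j) (a j) c))"
  \<comment> \<open>The normalizing factors are independent of \<open>c\<close> and collect in
    \<open>R\<close>; dividing by \<open>p ^ n\<close> then gives the exponent of \<open>p\<close>
    in the statement.\<close>
  have count: "of_nat (p ^ n) * N = of_real R * T"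
    unfolding N_def using card_solutions[OF assms(6), of a b]
    by (simp add: F_def R_def T_def prod.distrib sum_distrib_left mult_ac)
  have "R = real p powr (real (\<Sum>j<s. t j) / 2)"
    unfolding R_def by (simp add: sum_divide_distrib powr_sum)
  hence "real p powr (real (\<Sum>j<s. t j) / 2 - real n) = R / real (p ^ n)"
    by (simp add: powr_diff powr_realpow)
  hence "complex_of_real (real p powr (real (\<Sum>j<s. t j) / 2 - real n)) = of_real R / of_nat (p ^ n)"
    by simp
  moreover have "N = of_real R / of_nat (p ^ n) * T"
    using count by (simp add: field_simps)
  ultimately show ?thesis
    unfolding N_def[symmetric] T_def[symmetric] by simp
qed

end
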